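(* Let $T : SL^\infty\to SL^\infty$ be a bounded linear operator and $\eta > 0$. Then the identity operator $\mathrm{Id}$ on $SL^\infty$ factors through $H=T$ or $H=\mathrm{Id}-T$, i.e., for $H=T$ or for $H=\mathrm{Id}-T$ there exist bounded linear operators $R, S : SL^\infty\to SL^\infty$ such that $S\,H\,R=\mathrm{Id}$. Moreover, the operators $R$ and $S$ can be chosen with $\|R\|\, \|S\| \leq 2+\eta$. Consequently, the Banach space $SL^\infty$ is primary.
   Context: $\mathcal D$ denotes the collection of dyadic subintervals $[k2^{-n},(k+1)2^{-n})$, $n\ge 0$, $0\le k<2^n$, of $[0,1)$. For $I\in\mathcal D$, $h_I$ is the $L^\infty$-normalized Haar function: $h_I=+1$ on the left half of $I$, $-1$ on the right half of $I$, and $0$ elsewhere. All scalars are real. $SL^\infty$ is the (non-separable) Banach space of all formal series $f=\sum_{I\in\mathcal D} a_I h_I$ (identified with the coefficient family $(a_I)$; no convergence is implied) with finite norm $$\|f\|_{SL^\infty}=\Big\|\Big(\sum_{I\in\mathcal D} a_I^2 h_I^2\Big)^{1/2}\Big\|_{L^\infty}.$$ A Banach space $X$ is primary if for every bounded projection $Q:X\to X$, either $Q(X)$ or $(\mathrm{Id}-Q)(X)$ is isomorphic to $X$. *)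

theory Defs
  imports "HOL-Probability.Essential_Supremum"
begin

section \<open>Dyadic intervals and Haar functions\<close>

definition dyadic_intervals :: "real set set" where
  "dyadic_intervals = {{real k / 2 ^ n ..< (real k + 1) / 2 ^ n} | n k. k < (2::nat) ^ n}"

definition left_half :: "real set \<Rightarrow> real set" where
  "left_half I = {Inf I ..< (Inf I + Sup I) / 2}"

definition right_half :: "real set \<Rightarrow> real set" where
  "right_half I = {(Inf I + Sup I) / 2 ..< Sup I}"

definition haar :: "real set \<Rightarrow> real \<Rightarrow> real" where
  "haar I t = indicator (left_half I) t - indicator (right_half I) t"

lemma dyadic_intervals_cases:
  assumes "I \<in> dyadic_intervals"
  obtains l r where "I = {l..<r}" "0 \<le> l" "l < r" "r \<le> 1"
proof -
  obtain n k :: nat where I: "I = {real k / 2 ^ n ..< (real k + 1) / 2 ^ n}" and k: "k < 2 ^ n"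
    using assms by (auto simp: dyadic_intervals_def)
  have "k + 1 \<le> 2 ^ n" using k by simp
  then have "real (k + 1) \<le> real (2 ^ n)" by (rule of_nat_mono)
  then have "real k + 1 \<le> 2 ^ n" by simp
  then show ?thesis
    by (intro that[OF I]) (auto simp: divide_simps)
qed

lemma countable_dyadic_intervals: "countable dyadic_intervals"
proof -
  have "dyadic_intervals \<subseteq> (\<lambda>(n, k::nat). {real k / 2 ^ n ..< (real k + 1) / 2 ^ n}) ` (UNIV :: (nat \<times> nat) set)"
    by (auto simp: dyadic_intervals_def)
  then show ?thesis by (rule countable_subset) auto
qed

lemma abs_haar: "I \<in> dyadic_intervals \<Longrightarrow> t \<in> I \<Longrightarrow> \<bar>haar I t\<bar> = 1"
  by (elim dyadic_intervals_cases) (auto simp: haar_def left_half_def right_half_def indicator_def)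

lemma borel_measurable_haar [measurable]: "haar I \<in> borel_measurable borel"
  unfolding haar_def[abs_def] left_half_def right_half_def by measurable

section \<open>The space \<open>SL\<^sup>\<infinity>\<close>\<close>

definition ennreal_sqrt :: "ennreal \<Rightarrow> ennreal" where
  "ennreal_sqrt x = (if x = \<infinity> then \<infinity> else ennreal (sqrt (enn2real x)))"

text \<open>The square function and its \<open>L\<^sup>\<infinity>\<close>-norm take values in the extended nonnegative reals,
  so that they make sense for arbitrary coefficient families.\<close>

definition square_function :: "(real set \<Rightarrow> real) \<Rightarrow> real \<Rightarrow> ennreal" where
  "square_function a t =
     ennreal_sqrt (\<Sum>\<^sub>\<infinity>I\<in>dyadic_intervals. ennreal ((a I)\<^sup>2 * (haar I t)\<^sup>2))"

definition SL_norm :: "(real set \<Rightarrow> real) \<Rightarrow> ennreal" where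
  "SL_norm a = esssup (lebesgue_on {0..<1}) (square_function a)"

lemma ennreal_sqrt_le_iff:
  assumes "0 \<le> c"
  shows "ennreal_sqrt x \<le> ennreal c \<longleftrightarrow> x \<le> ennreal (c\<^sup>2)"
proof (cases x)
  case (real r)
  have "sqrt r \<le> c \<longleftrightarrow> r \<le> c\<^sup>2"
    using real_sqrt_le_iff[of r "c\<^sup>2"] assms by simp
  then show ?thesis using real assms by (simp add: ennreal_sqrt_def)
qed (simp add: ennreal_sqrt_def top_unique)

lemma square_function_le_iff:
  assumes "0 \<le> c"
  shows "square_function a t \<le> ennreal c \<longleftrightarrow>
    (\<forall>F. finite F \<and> F \<subseteq> dyadic_intervals \<longrightarrow> L2_set (\<lambda>I. a I * haar I t) F \<le> c)"
proof -
  have *: "(\<Sum>I\<in>F. ennreal ((a I)\<^sup>2 * (haar I t)\<^sup>2)) \<le> ennreal (c\<^sup>2)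
      \<longleftrightarrow> L2_set (\<lambda>I. a I * haar I t) F \<le> c" for F
  proof -
    have "L2_set (\<lambda>I. a I * haar I t) F \<le> c \<longleftrightarrow> (\<Sum>I\<in>F. (a I)\<^sup>2 * (haar I t)\<^sup>2) \<le> c\<^sup>2"
      unfolding L2_set_def power_mult_distrib
      using real_sqrt_le_iff[of "\<Sum>I\<in>F. (a I)\<^sup>2 * (haar I t)\<^sup>2" "c\<^sup>2"] assms by simp
    then show ?thesis by (simp add: sum_ennreal)
  qed
  have "square_function a t \<le> ennreal c \<longleftrightarrow>
     (SUP F\<in>{F. finite F \<and> F \<subseteq> dyadic_intervals}. \<Sum>I\<in>F. ennreal ((a I)\<^sup>2 * (haar I t)\<^sup>2)) \<le> ennreal (c\<^sup>2)"
    unfolding square_function_def ennreal_sqrt_le_iff[OF assms]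
    by (subst nonneg_infsum_complete) auto
  also have "\<dots> \<longleftrightarrow> (\<forall>F. finite F \<and> F \<subseteq> dyadic_intervals \<longrightarrow> L2_set (\<lambda>I. a I * haar I t) F \<le> c)"
    by (simp only: SUP_le_iff * Ball_def mem_Collect_eq)
  finally show ?thesis .
qed

lemma borel_measurable_square_function: "square_function a \<in> borel_measurable borel"
proof -
  have [measurable]: "ennreal_sqrt \<in> borel_measurable borel"
    unfolding ennreal_sqrt_def[abs_def] by measurable
  have "countable {F. finite F \<and> F \<subseteq> dyadic_intervals}"
    using countable_Collect_finite_subset[OF countable_dyadic_intervals] .
  then have "(\<lambda>t. SUP F\<in>{F. finite F \<and> F \<subseteq> dyadic_intervals}.
      \<Sum>I\<in>F. ennreal ((a I)\<^sup>2 * (haar I t)\<^sup>2)) \<in> borel_measurable borel"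
    by (intro borel_measurable_SUP) auto
  moreover have "square_function a = (\<lambda>t. ennreal_sqrt (SUP F\<in>{F. finite F \<and> F \<subseteq> dyadic_intervals}.
      \<Sum>I\<in>F. ennreal ((a I)\<^sup>2 * (haar I t)\<^sup>2)))"
    unfolding square_function_def by (subst nonneg_infsum_complete) auto
  ultimately show ?thesis by simp
qed

lemma SL_norm_le_iff:
  assumes "0 \<le> c"
  shows "SL_norm a \<le> ennreal c \<longleftrightarrow> (AE t in lebesgue_on {0..<1}.
    \<forall>F. finite F \<and> F \<subseteq> dyadic_intervals \<longrightarrow> L2_set (\<lambda>I. a I * haar I t) F \<le> c)"
proof -
  have m: "square_function a \<in> borel_measurable (lebesgue_on {0..<1})"
    using borel_measurable_square_function[of a]
    by (simp add: measurable_completion measurable_restrict_space1)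
  have "SL_norm a \<le> ennreal c \<longleftrightarrow> (AE t in lebesgue_on {0..<1}. square_function a t \<le> ennreal c)"
  proof
    assume "SL_norm a \<le> ennreal c"
    then show "AE t in lebesgue_on {0..<1}. square_function a t \<le> ennreal c"
      using esssup_AE[of "square_function a" "lebesgue_on {0..<1}"]
      by (auto simp: SL_norm_def elim!: eventually_mono)
  next
    assume "AE t in lebesgue_on {0..<1}. square_function a t \<le> ennreal c"
    then show "SL_norm a \<le> ennreal c"
      unfolding SL_norm_def by (rule esssup_I[OF m])
  qed
  then show ?thesis by (simp only: square_function_le_iff[OF assms])
qed

lemma AE_dyadic_ex:
  assumes "AE t in lebesgue_on {0..<1}. P t" "I \<in> dyadic_intervals"
  shows "\<exists>t\<in>I. P t"
proof (rule ccontr)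
  assume *: "\<not> (\<exists>t\<in>I. P t)"
  obtain l r where I: "I = {l..<r}" "0 \<le> l" "l < r" "r \<le> 1"
    using dyadic_intervals_cases[OF assms(2)] .
  have "AE t in lebesgue. t \<in> {0..<1} \<longrightarrow> P t"
    using assms(1) by (subst (asm) AE_restrict_space_iff) auto
  then have "AE t in lebesgue. t \<notin> I"
    by (rule eventually_mono) (use * I in auto)
  then have "emeasure lebesgue I = 0"
    using I by (subst (asm) AE_iff_measurable[where N = I]) auto
  then show False using I by simp
qed

lemma abs_coeff_le_SL_norm:
  assumes "SL_norm a \<le> ennreal c" "0 \<le> c" "I \<in> dyadic_intervals"
  shows "\<bar>a I\<bar> \<le> c"
proof -
  obtain t where t: "t \<in> I"
    "\<forall>F. finite F \<and> F \<subseteq> dyadic_intervals \<longrightarrow> L2_set (\<lambda>I. a I * haar I t) F \<le> c"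
    using AE_dyadic_ex[OF assms(1)[unfolded SL_norm_le_iff[OF assms(2)]] assms(3)] by blast
  from t(2)[rule_format, of "{I}"] show ?thesis
    using assms(3) t(1) by (simp add: L2_set_def abs_mult abs_haar)
qed

lemma SL_norm_zero: "SL_norm (\<lambda>I. 0) = 0"
proof -
  have "SL_norm (\<lambda>I. 0) \<le> ennreal 0"
    unfolding SL_norm_le_iff[OF order_refl] L2_set_def by (intro AE_I2) simp
  then show ?thesis by simp
qed

lemma SL_norm_add_le:
  assumes "SL_norm a \<le> ennreal c" "SL_norm b \<le> ennreal d" "0 \<le> c" "0 \<le> d"
  shows "SL_norm (\<lambda>I. a I + b I) \<le> ennreal (c + d)"
proof -
  have "AE t in lebesgue_on {0..<1}.
    \<forall>F. finite F \<and> F \<subseteq> dyadic_intervals \<longrightarrow> L2_set (\<lambda>I. (a I + b I) * haar I t) F \<le> c + d"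
    using assms(1,2)[unfolded SL_norm_le_iff[OF assms(3)] SL_norm_le_iff[OF assms(4)]]
  proof eventually_elim
    case (elim t)
    show ?case
    proof (intro allI impI)
      fix F assume F: "finite F \<and> F \<subseteq> dyadic_intervals"
      have "L2_set (\<lambda>I. (a I + b I) * haar I t) F
          \<le> L2_set (\<lambda>I. a I * haar I t) F + L2_set (\<lambda>I. b I * haar I t) F"
        unfolding distrib_right by (rule L2_set_triangle_ineq)
      also have "\<dots> \<le> c + d" using elim F by (intro add_mono) blast+
      finally show "L2_set (\<lambda>I. (a I + b I) * haar I t) F \<le> c + d" .
    qed
  qed
  then show ?thesis using assms by (subst SL_norm_le_iff) auto
qed

lemma SL_norm_scale_le:
  assumes "SL_norm a \<le> ennreal c" "0 \<le> c"
  shows "SL_norm (\<lambda>I. r * a I) \<le> ennreal (\<bar>r\<bar> * c)"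
proof -
  have "AE t in lebesgue_on {0..<1}.
    \<forall>F. finite F \<and> F \<subseteq> dyadic_intervals \<longrightarrow> L2_set (\<lambda>I. (r * a I) * haar I t) F \<le> \<bar>r\<bar> * c"
    using assms(1)[unfolded SL_norm_le_iff[OF assms(2)]]
  proof eventually_elim
    case (elim t)
    have "L2_set (\<lambda>I. (r * a I) * haar I t) F = \<bar>r\<bar> * L2_set (\<lambda>I. a I * haar I t) F" for F
      by (simp add: L2_set_def power_mult_distrib mult.assoc real_sqrt_mult flip: sum_distrib_left)
    then show ?case using elim by (auto intro!: mult_left_mono)
  qed
  then show ?thesis using assms by (subst SL_norm_le_iff) auto
qed

text \<open>A formal series is identified with its coefficient family, extended by \<open>0\<close> to arguments
  that are not dyadic intervals.\<close>

typedef SL_inf = "{a :: real set \<Rightarrow> real. (\<forall>I. I \<notin> dyadic_intervals \<longrightarrow> a I = 0) \<and> SL_norm a < \<infinity>}"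
  morphisms haar_coeff Abs_SL_inf
  by (rule exI[of _ "\<lambda>I. 0"]) (simp add: SL_norm_zero)

setup_lifting type_definition_SL_inf

lemma ennreal_less_infinity_iff: "x < (\<infinity>::ennreal) \<longleftrightarrow> (\<exists>c\<ge>0. x \<le> ennreal c)"
  by (cases x) (auto simp: top_unique)

lemma SL_norm_add_finite:
  assumes "SL_norm a < \<infinity>" "SL_norm b < \<infinity>"
  shows "SL_norm (\<lambda>I. a I + b I) < \<infinity>"
proof -
  obtain c d where "0 \<le> c" "SL_norm a \<le> ennreal c" "0 \<le> d" "SL_norm b \<le> ennreal d"
    using assms unfolding ennreal_less_infinity_iff by blast
  then have "SL_norm (\<lambda>I. a I + b I) \<le> ennreal (c + d)" by (intro SL_norm_add_le)
  then show ?thesis by (rule order.strict_trans1) simp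
qed

lemma SL_norm_scale_finite:
  assumes "SL_norm a < \<infinity>"
  shows "SL_norm (\<lambda>I. r * a I) < \<infinity>"
proof -
  obtain c where "0 \<le> c" "SL_norm a \<le> ennreal c"
    using assms unfolding ennreal_less_infinity_iff by blast
  then have "SL_norm (\<lambda>I. r * a I) \<le> ennreal (\<bar>r\<bar> * c)" by (intro SL_norm_scale_le)
  then show ?thesis by (rule order.strict_trans1) simp
qed

instantiation SL_inf :: real_vector
begin

lift_definition zero_SL_inf :: SL_inf is "\<lambda>I. 0" by (simp add: SL_norm_zero)

lift_definition plus_SL_inf :: "SL_inf \<Rightarrow> SL_inf \<Rightarrow> SL_inf" is "\<lambda>a b I. a I + b I"
  by (simp add: SL_norm_add_finite[simplified])

lift_definition scaleR_SL_inf :: "real \<Rightarrow> SL_inf \<Rightarrow> SL_inf" is "\<lambda>r a I. r * a I"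
  by (simp add: SL_norm_scale_finite[simplified])

lift_definition uminus_SL_inf :: "SL_inf \<Rightarrow> SL_inf" is "\<lambda>a I. - a I"
  using SL_norm_scale_finite[of _ "-1"] by simp

lift_definition minus_SL_inf :: "SL_inf \<Rightarrow> SL_inf \<Rightarrow> SL_inf" is "\<lambda>a b I. a I - b I"
  using SL_norm_add_finite[OF _ SL_norm_scale_finite[of _ "-1"]] by simp

instance
  by standard
    (simp_all add: haar_coeff_inject[symmetric] plus_SL_inf.rep_eq zero_SL_inf.rep_eq
      uminus_SL_inf.rep_eq minus_SL_inf.rep_eq scaleR_SL_inf.rep_eq fun_eq_iff algebra_simps)

end

instantiation SL_inf :: real_normed_vector
begin

definition norm_SL_inf :: "SL_inf \<Rightarrow> real" where
  "norm_SL_inf f = enn2real (SL_norm (haar_coeff f))"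

definition sgn_SL_inf :: "SL_inf \<Rightarrow> SL_inf" where
  "sgn_SL_inf f = f /\<^sub>R norm f"

definition dist_SL_inf :: "SL_inf \<Rightarrow> SL_inf \<Rightarrow> real" where
  "dist_SL_inf f g = norm (f - g)"

definition uniformity_SL_inf :: "(SL_inf \<times> SL_inf) filter" where
  "uniformity_SL_inf = (INF e\<in>{0 <..}. principal {(x, y). dist x y < e})"

definition open_SL_inf :: "SL_inf set \<Rightarrow> bool" where
  "open_SL_inf S = (\<forall>x\<in>S. \<forall>\<^sub>F (x', y) in uniformity. x' = x \<longrightarrow> y \<in> S)"

lemma SL_norm_haar_coeff: "SL_norm (haar_coeff f) = ennreal (norm (f::SL_inf))"
  using haar_coeff[of f] by (simp add: norm_SL_inf_def)

lemma norm_SL_inf_le_iff: "0 \<le> c \<Longrightarrow> norm (f::SL_inf) \<le> c \<longleftrightarrow> SL_norm (haar_coeff f) \<le> ennreal c"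
  by (simp add: SL_norm_haar_coeff)

lemma norm_SL_inf_nonneg: "0 \<le> norm (f::SL_inf)"
  by (simp add: norm_SL_inf_def)

lemma abs_haar_coeff_le_norm: "\<bar>haar_coeff f I\<bar> \<le> norm (f::SL_inf)"
proof (cases "I \<in> dyadic_intervals")
  case True
  then show ?thesis
    by (intro abs_coeff_le_SL_norm) (auto simp: SL_norm_haar_coeff norm_SL_inf_nonneg)
next
  case False
  then show ?thesis using haar_coeff[of f] norm_SL_inf_nonneg[of f] by simp
qed

instance
proof
  fix f g :: SL_inf and r :: real
  show "norm f = 0 \<longleftrightarrow> f = 0"
  proof
    assume "norm f = 0"
    then have "haar_coeff f I = 0" for I using abs_haar_coeff_le_norm[of f I] by simp
    then show "f = 0" by (simp add: haar_coeff_inject[symmetric] zero_SL_inf.rep_eq fun_eq_iff)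
  qed (simp add: norm_SL_inf_def zero_SL_inf.rep_eq SL_norm_zero)
  show "norm (f + g) \<le> norm f + norm g"
    unfolding norm_SL_inf_le_iff[OF add_nonneg_nonneg[OF norm_SL_inf_nonneg norm_SL_inf_nonneg]]
      plus_SL_inf.rep_eq
    by (rule SL_norm_add_le) (auto simp: SL_norm_haar_coeff norm_SL_inf_nonneg)
  have scale_le: "norm (s *\<^sub>R h) \<le> \<bar>s\<bar> * norm h" for s and h :: SL_inf
    unfolding norm_SL_inf_le_iff[OF mult_nonneg_nonneg[OF abs_ge_zero norm_SL_inf_nonneg]]
      scaleR_SL_inf.rep_eq
    by (rule SL_norm_scale_le) (auto simp: SL_norm_haar_coeff norm_SL_inf_nonneg)
  show "norm (r *\<^sub>R f) = \<bar>r\<bar> * norm f"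
  proof (cases "r = 0")
    case True
    then show ?thesis using scale_le[of r f] norm_SL_inf_nonneg[of "r *\<^sub>R f"] by simp
  next
    case False
    have "norm f \<le> \<bar>inverse r\<bar> * norm (r *\<^sub>R f)"
      using scale_le[of "inverse r" "r *\<^sub>R f"] False by simp
    then have "\<bar>r\<bar> * norm f \<le> \<bar>r\<bar> * (\<bar>inverse r\<bar> * norm (r *\<^sub>R f))"
      by (rule mult_left_mono) simp
    also have "\<dots> = norm (r *\<^sub>R f)" using False by (simp add: abs_inverse)
    finally show ?thesis using scale_le[of r f] by simp
  qed
qed (rule sgn_SL_inf_def dist_SL_inf_def uniformity_SL_inf_def open_SL_inf_def)+

end

instance SL_inf :: banach
proof
  fix X :: "nat \<Rightarrow> SL_inf"
  assume X: "Cauchy X"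
  have "Cauchy (\<lambda>n. haar_coeff (X n) I)" for I
  proof (rule metric_CauchyI)
    fix e :: real assume "0 < e"
    then obtain M where M: "\<And>m n. m \<ge> M \<Longrightarrow> n \<ge> M \<Longrightarrow> dist (X m) (X n) < e"
      using metric_CauchyD[OF X] by blast
    have "dist (haar_coeff (X m) I) (haar_coeff (X n) I) \<le> dist (X m) (X n)" for m n
      using abs_haar_coeff_le_norm[of "X m - X n" I]
      by (simp add: dist_real_def dist_norm minus_SL_inf.rep_eq)
    then show "\<exists>M. \<forall>m\<ge>M. \<forall>n\<ge>M. dist (haar_coeff (X m) I) (haar_coeff (X n) I) < e"
      using M by (meson le_less_trans)
  qed
  then have "\<forall>I. \<exists>l. (\<lambda>n. haar_coeff (X n) I) \<longlonglongrightarrow> l"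
    by (simp add: Cauchy_convergent_iff convergent_def)
  then obtain a where a: "\<And>I. (\<lambda>n. haar_coeff (X n) I) \<longlonglongrightarrow> a I" by metis
  have a0: "a I = 0" if "I \<notin> dyadic_intervals" for I
    using a[of I] haar_coeff that by (simp add: LIMSEQ_const_iff)
  have key: "\<exists>M. \<forall>n\<ge>M. SL_norm (\<lambda>I. haar_coeff (X n) I - a I) \<le> ennreal e" if "0 < e" for e
  proof -
    obtain M where M: "\<And>m n. m \<ge> M \<Longrightarrow> n \<ge> M \<Longrightarrow> dist (X m) (X n) < e"
      using metric_CauchyD[OF X \<open>0 < e\<close>] by blast
    have "SL_norm (\<lambda>I. haar_coeff (X n) I - a I) \<le> ennreal e" if n: "n \<ge> M" for n
    proof -
      have e: "0 \<le> e" using \<open>0 < e\<close> by simp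
      have 1: "AE t in lebesgue_on {0..<1}. \<forall>F. finite F \<and> F \<subseteq> dyadic_intervals \<longrightarrow>
          L2_set (\<lambda>I. (haar_coeff (X n) I - haar_coeff (X m) I) * haar I t) F \<le> e" if "m \<ge> M" for m
      proof -
        have "norm (X n - X m) \<le> e" using M[OF n that] by (simp add: dist_norm)
        then show ?thesis
          by (simp add: norm_SL_inf_le_iff[OF e] SL_norm_le_iff[OF e] minus_SL_inf.rep_eq)
      qed
      have "AE t in lebesgue_on {0..<1}. \<forall>m. m \<ge> M \<longrightarrow> (\<forall>F. finite F \<and> F \<subseteq> dyadic_intervals \<longrightarrow>
          L2_set (\<lambda>I. (haar_coeff (X n) I - haar_coeff (X m) I) * haar I t) F \<le> e)"
        unfolding AE_all_countable using 1 by (auto intro: AE_impI)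
      then have "AE t in lebesgue_on {0..<1}. \<forall>F. finite F \<and> F \<subseteq> dyadic_intervals \<longrightarrow>
          L2_set (\<lambda>I. (haar_coeff (X n) I - a I) * haar I t) F \<le> e"
      proof eventually_elim
        case (elim t)
        show ?case
        proof (intro allI impI)
          fix F assume F: "finite F \<and> F \<subseteq> dyadic_intervals"
          have "(\<lambda>m. L2_set (\<lambda>I. (haar_coeff (X n) I - haar_coeff (X m) I) * haar I t) F)
              \<longlonglongrightarrow> L2_set (\<lambda>I. (haar_coeff (X n) I - a I) * haar I t) F"
            unfolding L2_set_def by (intro tendsto_intros a)
          then show "L2_set (\<lambda>I. (haar_coeff (X n) I - a I) * haar I t) F \<le> e"
            by (rule LIMSEQ_le_const2) (use elim F in auto)
        qed
      qed
      then show ?thesis by (simp add: SL_norm_le_iff[OF e])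
    qed
    then show ?thesis by blast
  qed
  have "SL_norm a < \<infinity>"
  proof -
    obtain n where n: "SL_norm (\<lambda>I. haar_coeff (X n) I - a I) \<le> ennreal 1"
      using key[of 1] by auto
    have "SL_norm (\<lambda>I. haar_coeff (X n) I + (-1) * (haar_coeff (X n) I - a I))
        \<le> ennreal (norm (X n) + \<bar>-1\<bar> * 1)"
      by (intro SL_norm_add_le SL_norm_scale_le n) (auto simp: SL_norm_haar_coeff)
    then have "SL_norm a \<le> ennreal (norm (X n) + 1)" by simp
    then show ?thesis by (rule order.strict_trans1) simp
  qed
  with a0 have la: "haar_coeff (Abs_SL_inf a) = a" by (simp add: Abs_SL_inf_inverse)
  have "X \<longlonglongrightarrow> Abs_SL_inf a"
  proof (rule metric_LIMSEQ_I)
    fix e :: real assume e: "0 < e"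
    then obtain M where M: "\<forall>n\<ge>M. SL_norm (\<lambda>I. haar_coeff (X n) I - a I) \<le> ennreal (e / 2)"
      using key[of "e / 2"] by auto
    have "dist (X n) (Abs_SL_inf a) < e" if "n \<ge> M" for n
    proof -
      have "haar_coeff (X n - Abs_SL_inf a) = (\<lambda>I. haar_coeff (X n) I - a I)"
        by (simp add: minus_SL_inf.rep_eq la fun_eq_iff)
      then have "norm (X n - Abs_SL_inf a) \<le> e / 2"
        using M that e by (subst norm_SL_inf_le_iff) auto
      then show ?thesis using e by (simp add: dist_norm)
    qed
    then show "\<exists>M. \<forall>n\<ge>M. dist (X n) (Abs_SL_inf a) < e" by blast
  qed
  then show "convergent X" by (auto simp: convergent_def)
qed

section \<open>Primary Banach spaces\<close>

text \<open>Linear isomorphism, bounded in both directions, between linear subspaces of normed spaces.\<close>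

definition isomorphic_subspaces ::
    "'a::real_normed_vector set \<Rightarrow> 'b::real_normed_vector set \<Rightarrow> bool" where
  "isomorphic_subspaces U V \<longleftrightarrow> (\<exists>f.
     bij_betw f U V \<and>
     (\<forall>x\<in>U. \<forall>y\<in>U. f (x + y) = f x + f y) \<and>
     (\<forall>r. \<forall>x\<in>U. f (r *\<^sub>R x) = r *\<^sub>R f x) \<and>
     (\<exists>C. \<forall>x\<in>U. norm (f x) \<le> C * norm x \<and> norm x \<le> C * norm (f x)))"

definition bounded_projection :: "('a::real_normed_vector \<Rightarrow> 'a) \<Rightarrow> bool" where
  "bounded_projection Q \<longleftrightarrow> bounded_linear Q \<and> Q \<circ> Q = Q"

definition primary :: "'a::banach itself \<Rightarrow> bool" where
  "primary _ \<longleftrightarrow> (\<forall>Q :: 'a \<Rightarrow> 'a. bounded_projection Q \<longrightarrow>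
     isomorphic_subspaces (range Q) (UNIV :: 'a set) \<or>
     isomorphic_subspaces (range (\<lambda>x. x - Q x)) (UNIV :: 'a set))"

end

theory Submission
  imports Defs "HOL-Library.Sublist" "HOL-Library.Diagonal_Subsequence"
begin

text \<open>
  Only the squares of the Haar functions enter the norm, so \<open>SL\<^sup>\<infinity>\<close> is a space of functions on
  the infinite binary tree: the norm of a coefficient family is the supremum over all nodes of
  the \<open>\<ell>\<^sup>2\<close>-norm of the family along the path from the root to that node
  (\<open>SL_norm_le_iff_path_sum\<close>). Nodes are lists of booleans, the head being the last step, so that
  ancestors are suffixes. After this translation no measure theory is left.

  Factorization. To every node \<open>J\<close> one assigns a level \<open>\<nu> J\<close>, a finite set \<open>block \<nu> J\<close> of nodes of
  that level and signs, and takes the signed sum \<open>b\<^sub>J\<close> of the Haar functions in the block. The block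
  of the \<open>c\<close>-child of \<open>J\<close> consists of all nodes of its level that lie below the \<open>c\<close>-child of some
  member of the block of \<open>J\<close>. For every such choice with \<open>\<nu>\<close> increasing, \<open>h\<^sub>J \<mapsto> b\<^sub>J\<close> extends to a norm
  one embedding, and taking signed averages of coefficients over the blocks is a norm one left
  inverse of it. The levels and signs are chosen such that
  \<open>average \<circ> T \<circ> embed\<close> is a small perturbation of a multiplication operator with entries
  \<open>\<theta>\<^sub>J\<close>, all of which are at least \<open>1/2 - \<tau>\<close> or all of which are at most \<open>1/2 + \<tau>\<close>.
  In the second case \<open>T\<close> is replaced by \<open>Id - T\<close>. A contraction argument inverts the compressed
  operator, and its inverse has norm close to 2.

  Three observations make this choice possible, block by block in a fixed enumeration of the tree.
  (1) The influence of earlier blocks on a new one is small, because the coefficients of a fixed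
  vector tend to 0 in the mean over a level (\<open>level_averages_null\<close>).
  (2) The influence of later blocks cannot be controlled by finite sums, since \<open>T\<close> need not be
  weak* continuous. However, a bounded functional is almost zero on all vectors that are supported
  on the levels of a suitable infinite set (\<open>functional_small_on_sparse_levels\<close>); all later blocks
  use levels from that set only.
  (3) Suitable signs make \<open>\<theta>\<^sub>J\<close> at least (or at most) the average over the block of the diagonal
  entries of \<open>T\<close>. Along a subsequence of levels these entries converge weakly to a harmonic function
  \<open>d\<close> on the tree (\<open>ex_weak_limit\<close>). The increments of \<open>d\<close> tend to 0 in the mean, so the average
  of \<open>d\<close> over every block stays close to its value at the root (\<open>avg_d_cells\<close>), and whether this one
  number is at least \<open>1/2\<close> decides between \<open>T\<close> and \<open>Id - T\<close> for all blocks at once.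

  Primariness follows from the factorization by the decomposition method of Pelczynski. The subtrees
  hanging off the leftmost branch form an \<open>\<ell>\<^sup>\<infinity>\<close>-sum of copies of \<open>X = SL\<^sup>\<infinity>\<close> inside \<open>X\<close>, and shifting
  the \<open>Q\<close>-components of the copies by one place gives \<open>X \<cong> Q(X) \<times> X\<close> for each bounded projection
  \<open>Q\<close> (\<open>range_projection_absorbed\<close>). If the identity factors through \<open>Q\<close>, then moreover
  \<open>Q(X) \<cong> X \<times> V\<close> for some \<open>V\<close>, and both facts together give \<open>Q(X) \<cong> X\<close>.
\<close>

section \<open>The norm in terms of paths in the binary tree\<close>

primrec position :: "bool list \<Rightarrow> nat" where
  "position [] = 0"
| "position (b # K) = 2 * position K + of_bool b"

definition interval_of :: "bool list \<Rightarrow> real set" where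
  "interval_of K = {real (position K) / 2 ^ length K ..< (real (position K) + 1) / 2 ^ length K}"

text \<open>The value at \<open>K\<close> itself is left out: in this way the recursion needs no separate initial
  value, and since every node has children, the suprema over all nodes are the same.\<close>
primrec path_sum :: "(bool list \<Rightarrow> real) \<Rightarrow> bool list \<Rightarrow> real" where
  "path_sum a [] = 0"
| "path_sum a (b # K) = path_sum a K + (a K)\<^sup>2"

lemma position_less: "position K < 2 ^ length K"
  by (induction K) auto

lemma position_inj: "length K = length L \<Longrightarrow> position K = position L \<Longrightarrow> K = L"
proof (induction K L rule: list_induct2)
  case (Cons b K c L)
  have "b = c" using arg_cong[OF Cons.prems, of even] by (cases b; cases c) simp_all
  with Cons show ?case by simp
qed simp

lemma ex_position: "k < 2 ^ n \<Longrightarrow> \<exists>K. length K = n \<and> position K = k"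
proof (induction n arbitrary: k)
  case (Suc n)
  then have "k div 2 < 2 ^ n" by auto
  then obtain K where K: "length K = n" "position K = k div 2" using Suc.IH by blast
  have "position (odd k # K) = k" using K by simp
  with K show ?case by (intro exI[of _ "odd k # K"]) simp
qed simp

lemma mem_interval_iff: "t \<in> interval_of K \<longleftrightarrow> \<lfloor>t * 2 ^ length K\<rfloor> = int (position K)"
  unfolding interval_of_def by (auto simp: floor_eq_iff divide_simps)

lemma interval_of_inj: assumes "interval_of K = interval_of L" shows "K = L"
proof -
  have lt: "real (position M) / 2 ^ length M < (real (position M) + 1) / 2 ^ length M" for M
    by (simp add: divide_simps)
  have eq: "real (position K) / 2 ^ length K = real (position L) / 2 ^ length L"
       "(real (position K) + 1) / 2 ^ length K = (real (position L) + 1) / 2 ^ length L"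
    using assms lt[of K] lt[of L] unfolding interval_of_def
    by (metis cInf_atLeastLessThan, metis cSup_atLeastLessThan)
  have "1 / 2 ^ length K = (1 / 2 ^ length L :: real)"
    using eq by (simp add: add_divide_distrib)
  then have "(2::real) ^ length K = 2 ^ length L" by simp
  then have l: "length K = length L" by simp
  then have "position K = position L" using eq(1) by simp
  with l show ?thesis by (rule position_inj)
qed

lemma range_interval_of: "range interval_of = dyadic_intervals"
proof
  show "range interval_of \<subseteq> dyadic_intervals"
    unfolding interval_of_def dyadic_intervals_def using position_less by blast
  show "dyadic_intervals \<subseteq> range interval_of"
    unfolding dyadic_intervals_def interval_of_def using ex_position by fastforce
qed

lemma bij_interval_of: "bij_betw interval_of UNIV dyadic_intervals"
  by (auto simp: bij_betw_def range_interval_of intro!: injI interval_of_inj)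

lemma interval_of_dyadic [simp]: "interval_of K \<in> dyadic_intervals"
  using range_interval_of by blast

lemma mem_interval_Cons: "t \<in> interval_of (b # K) \<Longrightarrow> t \<in> interval_of K"
proof -
  assume "t \<in> interval_of (b # K)"
  then have "\<lfloor>2 * (t * 2 ^ length K)\<rfloor> = 2 * int (position K) + of_bool b"
    unfolding mem_interval_iff by (simp add: mult_ac)
  then show ?thesis unfolding mem_interval_iff by (cases b) (simp_all add: floor_eq_iff)
qed

lemma mem_interval_suffix: "suffix L K \<Longrightarrow> t \<in> interval_of K \<Longrightarrow> t \<in> interval_of L"
  by (induction K) (auto simp: suffix_Cons dest: mem_interval_Cons)

lemma mem_interval_unique: "t \<in> interval_of K \<Longrightarrow> t \<in> interval_of L \<Longrightarrow> length K = length L \<Longrightarrow> K = L"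
  unfolding mem_interval_iff by (intro position_inj) simp_all

lemma ex_interval_of: assumes "0 \<le> t" "t < 1" shows "\<exists>K. length K = n \<and> t \<in> interval_of K"
proof -
  have "t * 2 ^ n < 2 ^ n" using assms by simp
  then have "\<lfloor>t * 2 ^ n\<rfloor> < 2 ^ n" by (simp add: floor_less_iff)
  moreover have "0 \<le> \<lfloor>t * 2 ^ n\<rfloor>" using assms by simp
  ultimately have "nat \<lfloor>t * 2 ^ n\<rfloor> < 2 ^ n" by (simp add: nat_less_iff)
  then obtain K where "length K = n" "position K = nat \<lfloor>t * 2 ^ n\<rfloor>" using ex_position by blast
  with \<open>0 \<le> \<lfloor>t * 2 ^ n\<rfloor>\<close> show ?thesis unfolding mem_interval_iff by auto
qed

lemma finite_strict_suffixes: "finite {L. strict_suffix L K}"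
  by (rule finite_subset[of _ "set (suffixes K)"]) (auto simp: strict_suffix_def)

lemma path_sum_eq_sum: "path_sum a K = (\<Sum>L | strict_suffix L K. (a L)\<^sup>2)"
proof (induction K)
  case (Cons b K)
  have "{L. strict_suffix L (b # K)} = insert K {L. strict_suffix L K}"
    by (auto simp: strict_suffix_def suffix_Cons dest: suffix_length_le)
  then show ?case using Cons finite_strict_suffixes[of K] by simp
qed simp

lemma haar_outside: "I \<in> dyadic_intervals \<Longrightarrow> t \<notin> I \<Longrightarrow> haar I t = 0"
  by (elim dyadic_intervals_cases) (auto simp: haar_def left_half_def right_half_def indicator_def)

lemma haar_sq: "I \<in> dyadic_intervals \<Longrightarrow> (haar I t)\<^sup>2 = of_bool (t \<in> I)"
  using abs_haar[of I t] haar_outside[of I t] power2_abs[of "haar I t"] by (cases "t \<in> I") auto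

lemma L2_haar_le_iff:
  assumes "0 \<le> c" "finite F" "F \<subseteq> dyadic_intervals"
  shows "L2_set (\<lambda>I. a I * haar I t) F \<le> c \<longleftrightarrow> (\<Sum>I | I \<in> F \<and> t \<in> I. (a I)\<^sup>2) \<le> c\<^sup>2"
proof -
  have "(\<Sum>I\<in>F. (a I * haar I t)\<^sup>2) = (\<Sum>I | I \<in> F \<and> t \<in> I. (a I)\<^sup>2)"
    
    using assms haar_outside[of _ t]
    by (intro sum.mono_neutral_cong_right) (auto simp: power_mult_distrib haar_sq subset_iff)
  moreover have "sqrt x \<le> c \<longleftrightarrow> x \<le> c\<^sup>2" for x
    using real_sqrt_le_iff[of x "c\<^sup>2"] assms by simp
  ultimately show ?thesis by (simp add: L2_set_def)
qed

text \<open>A point \<open>t\<close> lies in exactly the intervals of one infinite branch, so at \<open>t\<close> a finite part of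
  the square function is bounded by a sum along an initial piece of this branch. Conversely, the
  path sum at \<open>K\<close> is a lower bound for the squared square function on the whole interval of \<open>K\<close>,
  and this has positive measure.\<close>
lemma SL_norm_le_iff_path_sum:
  assumes "0 \<le> c"
  shows "SL_norm a \<le> ennreal c \<longleftrightarrow> (\<forall>K. path_sum (a \<circ> interval_of) K \<le> c\<^sup>2)"
proof
  assume "SL_norm a \<le> ennreal c"
  then have ae: "AE t in lebesgue_on {0..<1}.
    \<forall>F. finite F \<and> F \<subseteq> dyadic_intervals \<longrightarrow> L2_set (\<lambda>I. a I * haar I t) F \<le> c"
    by (simp add: SL_norm_le_iff[OF assms])
  show "\<forall>K. path_sum (a \<circ> interval_of) K \<le> c\<^sup>2"
  proof
    fix K
    obtain t where t: "t \<in> interval_of K"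
      "\<And>F. finite F \<and> F \<subseteq> dyadic_intervals \<longrightarrow> L2_set (\<lambda>I. a I * haar I t) F \<le> c"
      using AE_dyadic_ex[OF ae interval_of_dyadic[of K]] by blast
    let ?F = "interval_of ` {L. strict_suffix L K}"
    have F: "finite ?F" "?F \<subseteq> dyadic_intervals" using finite_strict_suffixes by auto
    have "{I. I \<in> ?F \<and> t \<in> I} = ?F"
      using mem_interval_suffix[OF _ t(1)] by (auto simp: strict_suffix_def)
    then have "path_sum (a \<circ> interval_of) K = (\<Sum>I | I \<in> ?F \<and> t \<in> I. (a I)\<^sup>2)"
      by (simp add: path_sum_eq_sum sum.reindex inj_on_def interval_of_inj)
    also have "\<dots> \<le> c\<^sup>2"
      using t(2) F L2_haar_le_iff[OF assms F] by blast
    finally show "path_sum (a \<circ> interval_of) K \<le> c\<^sup>2" .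
  qed
next
  assume *: "\<forall>K. path_sum (a \<circ> interval_of) K \<le> c\<^sup>2"
  have "L2_set (\<lambda>I. a I * haar I t) F \<le> c"
    if t: "0 \<le> t" "t < 1" and F: "finite F" "F \<subseteq> dyadic_intervals" for t F
  proof -
    define len where "len I = length (inv interval_of I)" for I
    \<comment> \<open>Beyond all levels that occur in \<open>F\<close>; the successor is needed because the path sum at a node
      omits the node itself.\<close>
    define n where "n = Suc (Max (insert 0 (len ` F)))"
    obtain K where K: "length K = n" "t \<in> interval_of K" using ex_interval_of[OF t] by blast
    have sub: "{I. I \<in> F \<and> t \<in> I} \<subseteq> interval_of ` {L. strict_suffix L K}"
    proof
      fix I assume "I \<in> {I. I \<in> F \<and> t \<in> I}"
      then have I: "I \<in> F" "t \<in> I" by auto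
      then obtain L where L: "I = interval_of L" using F range_interval_of by blast
      then have "len I = length L" unfolding len_def using bij_interval_of
        by (simp add: inv_f_f bij_betw_def)
      moreover have "len I < n" unfolding n_def using F I by (auto simp: less_Suc_eq_le)
      ultimately have ln: "length L < length K" using K by simp
      have suf: "suffix (drop (length K - length L) K) K" by (rule suffix_drop)
      then have "t \<in> interval_of (drop (length K - length L) K)" using K mem_interval_suffix
        by blast
      moreover have "t \<in> interval_of L" using I(2) L by simp
      ultimately have Leq: "L = drop (length K - length L) K"
        using ln by (intro mem_interval_unique) simp_all
      have "suffix L K" by (subst Leq) (rule suf)
      then have "strict_suffix L K" using ln by (auto simp: strict_suffix_def)
      then show "I \<in> interval_of ` {L. strict_suffix L K}" using L by simp
    qed
    have "(\<Sum>I | I \<in> F \<and> t \<in> I. (a I)\<^sup>2) \<le> (\<Sum>I\<in>interval_of ` {L. strict_suffix L K}. (a I)\<^sup>2)"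
      using sub finite_strict_suffixes by (intro sum_mono2) auto
    also have "\<dots> = path_sum (a \<circ> interval_of) K"
      by (simp add: path_sum_eq_sum sum.reindex inj_on_def interval_of_inj)
    also have "\<dots> \<le> c\<^sup>2" using * by blast
    finally show ?thesis by (simp add: L2_haar_le_iff[OF assms F])
  qed
  then show "SL_norm a \<le> ennreal c"
    unfolding SL_norm_le_iff[OF assms] by (intro AE_I2) (auto simp: space_restrict_space)
qed

definition coef :: "SL_inf \<Rightarrow> bool list \<Rightarrow> real" where
  "coef f K = haar_coeff f (interval_of K)"

definition of_coef :: "(bool list \<Rightarrow> real) \<Rightarrow> SL_inf" where
  "of_coef a = Abs_SL_inf (\<lambda>I. if I \<in> dyadic_intervals then a (inv interval_of I) else 0)"

lemma SL_eqI: assumes "\<And>K. coef f K = coef g K" shows "f = g"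
proof -
  have "haar_coeff f I = haar_coeff g I" for I
  proof (cases "I \<in> dyadic_intervals")
    case True
    then obtain K where "I = interval_of K" using range_interval_of by blast
    with assms[of K] show ?thesis by (simp add: coef_def)
  next
    case False then show ?thesis using haar_coeff[of f] haar_coeff[of g] by simp
  qed
  then show ?thesis by (simp add: haar_coeff_inject[symmetric] fun_eq_iff)
qed

lemma norm_le_iff_path_sum: "0 \<le> c \<Longrightarrow> norm f \<le> c \<longleftrightarrow> (\<forall>K. path_sum (coef f) K \<le> c\<^sup>2)"
  unfolding norm_SL_inf_le_iff SL_norm_le_iff_path_sum by (simp add: coef_def[abs_def] comp_def)

lemma path_sum_le_norm: "path_sum (coef f) K \<le> (norm f)\<^sup>2"
  using norm_le_iff_path_sum[of "norm f" f] by simp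

lemma coef_of_coef:
  assumes "\<And>K. path_sum a K \<le> c"
  shows "coef (of_coef a) = a"
proof -
  let ?a = "\<lambda>I. if I \<in> dyadic_intervals then a (inv interval_of I) else 0"
  have c: "?a \<circ> interval_of = a" using bij_interval_of
    by (auto simp: fun_eq_iff bij_betw_def inv_f_f)
  have "0 \<le> c" using assms[of "[]"] by simp
  then have "SL_norm ?a \<le> ennreal (sqrt c)"
    using assms by (subst SL_norm_le_iff_path_sum) (simp_all add: c)
  then have "SL_norm ?a < \<infinity>" by (rule order.strict_trans1) simp
  then have "haar_coeff (of_coef a) = ?a" unfolding of_coef_def by (intro Abs_SL_inf_inverse) auto
  then show ?thesis using c by (auto simp: coef_def fun_eq_iff)
qed

lemma coef_add [simp]: "coef (f + g) K = coef f K + coef g K"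
  and coef_diff [simp]: "coef (f - g) K = coef f K - coef g K"
  and coef_scale [simp]: "coef (r *\<^sub>R f) K = r * coef f K"
  and coef_zero [simp]: "coef 0 K = 0"
  by (simp_all add: coef_def plus_SL_inf.rep_eq minus_SL_inf.rep_eq scaleR_SL_inf.rep_eq
    zero_SL_inf.rep_eq)

lemma coef_sum [simp]: "coef (sum f S) K = (\<Sum>i\<in>S. coef (f i) K)"
  by (induction S rule: infinite_finite_induct) auto

lemma abs_coef_le_norm: "\<bar>coef f K\<bar> \<le> norm f"
  unfolding coef_def by (rule abs_haar_coeff_le_norm)

lemma path_sum_nonneg: "0 \<le> path_sum a K"
  by (induction K) auto

lemma path_sum_cong_le: "(\<And>K. \<bar>a K\<bar> \<le> \<bar>b K\<bar>) \<Longrightarrow> path_sum a K \<le> path_sum b K"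
  by (induction K) (auto intro!: add_mono simp: abs_le_square_iff)

definition haar_vec :: "bool list \<Rightarrow> SL_inf" where
  "haar_vec L = of_coef (\<lambda>K. of_bool (K = L))"

lemma path_sum_unit: "path_sum (\<lambda>K. of_bool (K = L)) K = of_bool (strict_suffix L K)"
proof -
  have "path_sum (\<lambda>K. of_bool (K = L)) K = (\<Sum>M | strict_suffix M K. if M = L then 1 else 0)"
    unfolding path_sum_eq_sum by (intro sum.cong) auto
  also have "\<dots> = of_bool (strict_suffix L K)" using finite_strict_suffixes[of K] by simp
  finally show ?thesis .
qed

lemma coef_haar_vec [simp]: "coef (haar_vec L) K = of_bool (K = L)"
proof -
  have "path_sum (\<lambda>K. of_bool (K = L)) K \<le> 1" for K by (simp add: path_sum_unit)
  from coef_of_coef[OF this] show ?thesis unfolding haar_vec_def by (simp add: fun_eq_iff)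
qed

lemma norm_haar_vec_le: "norm (haar_vec L) \<le> 1"
  unfolding norm_le_iff_path_sum[OF zero_le_one] coef_haar_vec[abs_def] path_sum_unit by simp

section \<open>Averages over generations of the tree\<close>

definition level :: "nat \<Rightarrow> bool list set" where
  "level n = {K. length K = n}"

definition descendants :: "bool list set \<Rightarrow> nat \<Rightarrow> bool list set" where
  "descendants C n = {K. length K = n \<and> (\<exists>L\<in>C. suffix L K)}"

definition children :: "bool list set \<Rightarrow> bool list set" where
  "children S = (#) False ` S \<union> (#) True ` S"

definition avg :: "bool list set \<Rightarrow> (bool list \<Rightarrow> real) \<Rightarrow> real" where
  "avg S g = (\<Sum>K\<in>S. g K) / card S"

lemma avg_add: "avg S (\<lambda>K. g K + h K) = avg S g + avg S h"
  by (simp add: avg_def sum.distrib add_divide_distrib)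

lemma avg_cmult: "avg S (\<lambda>K. c * g K) = c * avg S g"
  by (simp add: avg_def flip: sum_distrib_left)

lemma avg_const: "finite S \<Longrightarrow> S \<noteq> {} \<Longrightarrow> avg S (\<lambda>_. c) = c"
  by (simp add: avg_def)

lemma avg_cong: "(\<And>K. K \<in> S \<Longrightarrow> g K = h K) \<Longrightarrow> avg S g = avg S h"
  by (simp add: avg_def)

lemma avg_mono: "(\<And>K. K \<in> S \<Longrightarrow> g K \<le> h K) \<Longrightarrow> avg S g \<le> avg S h"
  by (simp add: avg_def divide_right_mono sum_mono)

lemma avg_nonneg: "(\<And>K. K \<in> S \<Longrightarrow> 0 \<le> g K) \<Longrightarrow> 0 \<le> avg S g"
  by (simp add: avg_def sum_nonneg)

lemma abs_avg_le: "\<bar>avg S g\<bar> \<le> avg S (\<lambda>K. \<bar>g K\<bar>)"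
  by (simp add: avg_def divide_right_mono)

lemma avg_le_const: "(\<And>K. K \<in> S \<Longrightarrow> g K \<le> c) \<Longrightarrow> 0 \<le> c \<Longrightarrow> avg S g \<le> c"
  using sum_mono[of S g "\<lambda>_. c"]
    by (cases "card S = 0") (simp_all add: avg_def divide_simps mult.commute)

lemma avg_sq_le: "(avg S g)\<^sup>2 \<le> avg S (\<lambda>K. (g K)\<^sup>2)"
proof (cases "card S = 0")
  case False
  have "(\<Sum>K\<in>S. g K * 1)\<^sup>2 \<le> (\<Sum>K\<in>S. (g K)\<^sup>2) * (\<Sum>K\<in>S. 1\<^sup>2)"
    by (rule Cauchy_Schwarz_ineq_sum)
  with False show ?thesis by (simp add: avg_def divide_simps power2_eq_square mult.assoc)
qed (auto simp: avg_def)

lemma finite_level: "finite (level n)"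
proof -
  have "level n = {K. set K \<subseteq> (UNIV :: bool set) \<and> length K = n}" by (auto simp: level_def)
  then show ?thesis using finite_lists_length_eq[of "UNIV :: bool set" n] by simp
qed

lemma descendants_subset_level: "descendants C n \<subseteq> level n"
  by (auto simp: descendants_def level_def)

lemma finite_descendants: "finite (descendants C n)"
  using descendants_subset_level finite_level finite_subset by blast

lemma finite_sub_level: "C \<subseteq> level m \<Longrightarrow> finite C"
  using finite_level finite_subset by blast

lemma descendants_same: "C \<subseteq> level m \<Longrightarrow> descendants C m = C"
proof -
  assume C: "C \<subseteq> level m"
  have "K = L" if "suffix L K" "length K = length L" for K L :: "bool list"
    using that by (metis append_Nil append_take_drop_id append_eq_append_conv suffix_def)
  with C show ?thesis by (fastforce simp: descendants_def level_def)
qed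

lemma descendants_Suc: assumes "C \<subseteq> level m" "m \<le> n" shows "descendants C (Suc n)
  = children (descendants C n)"
proof -
  have "K \<in> descendants C (Suc n) \<longleftrightarrow> K \<in> children (descendants C n)" for K
  proof (cases K)
    case Nil then show ?thesis by (auto simp: descendants_def children_def)
  next
    case (Cons b K')
    have "(\<exists>L\<in>C. suffix L (b # K')) \<longleftrightarrow> (\<exists>L\<in>C. suffix L K')" if "length K' = n"
      using assms that by (force simp: suffix_Cons level_def)
    then show ?thesis using Cons by (cases b) (auto simp: descendants_def children_def)
  qed
  then show ?thesis by blast
qed

lemma level_eq_descendants: "level n = descendants {[]} n"
  by (auto simp: level_def descendants_def)

lemma level_Suc: "level (Suc n) = children (level n)"
  unfolding level_eq_descendants by (rule descendants_Suc[of _ 0]) (auto simp: level_def)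

lemma card_children: "finite S \<Longrightarrow> card (children S) = 2 * card S"
  unfolding children_def by (subst card_Un_disjoint) (auto simp: card_image)

lemma avg_children:
  assumes "finite S"
  shows "avg (children S) g = avg S (\<lambda>K. (g (False # K) + g (True # K)) / 2)"
proof -
  have "sum g (children S) = (\<Sum>K\<in>S. g (False # K) + g (True # K))"
    unfolding children_def using assms
    by (subst sum.union_disjoint) (auto simp: sum.reindex sum.distrib)
  then show ?thesis using assms
    by (simp add: avg_def card_children flip: sum_divide_distrib)
qed

lemma avg_Cons_image: "avg ((#) b ` S) g = avg S (\<lambda>K. g (b # K))"
  unfolding avg_def by (simp add: sum.reindex card_image)

lemma avg_descendants_Suc:
  assumes "C \<subseteq> level m" "m \<le> n"
  shows "avg (descendants C (Suc n)) g
    = avg (descendants C n) (\<lambda>K. (g (False # K) + g (True # K)) / 2)"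
  by (simp add: descendants_Suc[OF assms] avg_children finite_descendants)

lemma avg_level_Suc: "avg (level (Suc n)) g
  = avg (level n) (\<lambda>K. (g (False # K) + g (True # K)) / 2)"
  by (simp add: level_Suc avg_children finite_level)

lemma avg_descendants_mono:
  assumes "C \<subseteq> level m" "m \<le> n" "\<And>b K. g K \<le> g (b # K)"
  shows "avg C g \<le> avg (descendants C n) g"
  using assms(2)
proof (induction n rule: dec_induct)
  case base then show ?case by (simp add: descendants_same[OF assms(1)])
next
  case (step n)
  have "g K \<le> (g (False # K) + g (True # K)) / 2" for K
    using assms(3)[of K False] assms(3)[of K True] by simp
  then have "avg (descendants C n) g \<le> avg (descendants C (Suc n)) g"
    unfolding avg_descendants_Suc[OF assms(1) step.hyps(1)] by (intro avg_mono)
  with step show ?case by linarith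
qed

lemma avg_descendants_harmonic:
  assumes "C \<subseteq> level m" "m \<le> n" "\<And>K. g K = (g (False # K) + g (True # K)) / 2"
  shows "avg (descendants C n) g = avg C g"
  using assms(2)
proof (induction n rule: dec_induct)
  case base then show ?case by (simp add: descendants_same[OF assms(1)])
next
  case (step n)
  then show ?case
    by (simp only: avg_descendants_Suc[OF assms(1) step.hyps(1)] assms(3)[symmetric])
qed

text \<open>All members of \<open>C\<close> have the same number of descendants at level \<open>n\<close>, so averaging may be
  done in two stages.\<close>
lemma avg_descendants_split:
  assumes "C \<subseteq> level m" "m \<le> n"
  shows "avg (descendants C n) g = avg C (\<lambda>L. avg (descendants {L} n) g)"
  using assms(2)
proof (induction n arbitrary: g rule: dec_induct)
  case base
  have "avg C g = avg C (\<lambda>L. avg (descendants {L} m) g)"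
  proof (rule avg_cong)
    fix L assume "L \<in> C"
    then have "descendants {L} m = {L}" using assms(1) by (intro descendants_same) auto
    then show "g L = avg (descendants {L} m) g" by (simp add: avg_def)
  qed
  then show ?case by (simp add: descendants_same[OF assms(1)])
next
  case (step n)
  have "avg (descendants {L} (Suc n)) g
    = avg (descendants {L} n) (\<lambda>K. (g (False # K) + g (True # K)) / 2)" if "L \<in> C" for L
    using assms(1) that step.hyps(1) by (intro avg_descendants_Suc[of _ m]) auto
  then show ?case
    unfolding avg_descendants_Suc[OF assms(1) step.hyps(1)] step.IH by (intro avg_cong) simp
qed

lemma card_descendants:
  assumes "C \<subseteq> level m" "m \<le> n"
  shows "card (descendants C n) * 2 ^ m = card C * 2 ^ n"
  using assms(2)
proof (induction n rule: dec_induct)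
  case base then show ?case by (simp add: descendants_same[OF assms(1)])
next
  case (step n)
  have "card (descendants C (Suc n)) = 2 * card (descendants C n)"
    by (simp add: descendants_Suc[OF assms(1) step.hyps(1)] card_children finite_descendants)
  with step.IH show ?case by (simp only: power_Suc mult.assoc mult.left_commute)
qed

lemma descendants_nonempty:
  assumes "C \<subseteq> level m" "m \<le> n" "C \<noteq> {}"
  shows "descendants C n \<noteq> {}"
proof
  assume "descendants C n = {}"
  then show False using card_descendants[OF assms(1,2)] finite_sub_level[OF assms(1)] assms(3)
    by simp
qed

lemma card_level: "card (level n) = 2 ^ n"
  using card_descendants[of "{[]}" 0 n] unfolding level_eq_descendants
    by (simp add: descendants_def)

text \<open>A nonempty set of nodes of level \<open>m\<close> covers at least the fraction \<open>1 / 2 ^ m\<close> of each later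
  level.\<close>
lemma avg_descendants_le:
  assumes "C \<subseteq> level m" "m \<le> n" "C \<noteq> {}" "\<And>K. 0 \<le> g K"
  shows "avg (descendants C n) g \<le> 2 ^ m * avg (level n) g"
proof -
  have c: "card C \<ge> 1" using assms finite_sub_level[OF assms(1)]
    by (simp add: Suc_le_eq card_gt_0_iff)
  have cd: "card (descendants C n) \<noteq> 0"
    using descendants_nonempty[OF assms(1-3)] finite_descendants by simp
  have "(2::nat) ^ n \<le> card (descendants C n) * 2 ^ m"
    unfolding card_descendants[OF assms(1,2)] using c by simp
  then have "real (2 ^ n) \<le> real (card (descendants C n) * 2 ^ m)" by (rule of_nat_mono)
  then have le: "2 ^ n \<le> card (descendants C n) * (2::real) ^ m" by simp
  have s: "0 \<le> sum g (descendants C n)" "sum g (descendants C n) \<le> sum g (level n)"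
    using assms(4) descendants_subset_level finite_level by (auto intro!: sum_nonneg sum_mono2)
  have "sum g (descendants C n) * 2 ^ n \<le> sum g (level n) * (card (descendants C n) * 2 ^ m)"
    using s le by (intro mult_mono) auto
  then show ?thesis using cd by (simp add: avg_def card_level field_simps)
qed

lemma avg_path_sum_Suc:
  "avg (level (Suc n)) (path_sum a) = avg (level n) (path_sum a) + avg (level n) (\<lambda>K. (a K)\<^sup>2)"
proof -
  have "(path_sum a (False # K) + path_sum a (True # K)) / 2 = path_sum a K + (a K)\<^sup>2" for K
    by simp
  then show ?thesis by (simp only: avg_level_Suc avg_add)
qed

text \<open>The mean of the path sums at level \<open>n\<close> is the sum over all earlier levels of the mean of \<open>(a
  K)\<^sup>2\<close>. If these sums are bounded, then the means of the squares form a summable sequence.\<close>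
lemma level_averages_null:
  assumes "\<And>n. avg (level n) (path_sum a) \<le> M"
  shows "(\<lambda>n. avg (level n) (\<lambda>K. \<bar>a K\<bar>)) \<longlonglongrightarrow> 0"
proof -
  let ?v = "\<lambda>n. avg (level n) (\<lambda>K. (a K)\<^sup>2)"
  have "(\<Sum>k<n. ?v k) = avg (level n) (path_sum a)" for n
  proof (induction n)
    case 0 show ?case by (simp add: avg_def level_def)
  qed (simp add: avg_path_sum_Suc)
  then have "summable ?v"
    using assms by (intro summableI_nonneg_bounded[where x = M] avg_nonneg) auto
  then have "?v \<longlonglongrightarrow> 0" by (rule summable_LIMSEQ_zero)
  then have "(\<lambda>n. sqrt (?v n)) \<longlonglongrightarrow> sqrt 0" by (intro tendsto_intros)
  then have lim: "(\<lambda>n. sqrt (?v n)) \<longlonglongrightarrow> 0" by simp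
  have "avg (level n) (\<lambda>K. \<bar>a K\<bar>) \<le> sqrt (?v n)" for n
    using avg_sq_le[of "level n" "\<lambda>K. \<bar>a K\<bar>"] by (intro real_le_rsqrt) simp
  then show ?thesis
    by (intro tendsto_sandwich[OF _ _ tendsto_const lim] always_eventually allI avg_nonneg) auto
qed

lemma level_averages_null_SL: "(\<lambda>n. avg (level n) (\<lambda>K. \<bar>coef f K\<bar>)) \<longlonglongrightarrow> 0"
  by (rule level_averages_null[where M = "(norm f)\<^sup>2"])
    (intro avg_le_const path_sum_le_norm zero_le_power2)

lemma sq_sum_orthogonal:
  fixes u :: "'i \<Rightarrow> real"
  assumes "finite S" "\<And>i j. i \<in> S \<Longrightarrow> j \<in> S \<Longrightarrow> i \<noteq> j \<Longrightarrow> u i = 0 \<or> u j = 0"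
  shows "(sum u S)\<^sup>2 = (\<Sum>i\<in>S. (u i)\<^sup>2)"
  using assms
proof (induction S)
  case (insert x S)
  show ?case
  proof (cases "u x = 0")
    case True then show ?thesis using insert by simp
  next
    case False
    then have "u i = 0" if "i \<in> S" for i using insert.hyps insert.prems[of x i] that by auto
    then show ?thesis using insert.hyps by simp
  qed
qed simp

text \<open>Split \<open>N\<close> into \<open>m\<close> infinite parts. If the functional had values larger than \<open>e\<close> on
  normalized vectors \<open>x\<^sub>i\<close> supported on the levels of the \<open>i\<close>-th part, for each \<open>i < m\<close>, then it
  would be larger than \<open>m * e\<close> on their sum with suitable signs. But vectors with disjoint levels
  add in the \<open>\<ell>\<^sup>2\<close>-sense along every path, so that this sum has norm at most \<open>sqrt m\<close>: impossible
  for large \<open>m\<close>.\<close>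
lemma functional_small_on_sparse_levels:
  fixes \<phi> :: "SL_inf \<Rightarrow> real"
  assumes "bounded_linear \<phi>" "infinite N" "0 < e"
  shows "\<exists>N'\<subseteq>N. infinite N' \<and>
    (\<forall>x. (\<forall>K. coef x K \<noteq> 0 \<longrightarrow> length K \<in> N') \<longrightarrow> \<bar>\<phi> x\<bar> \<le> e * norm x)"
proof (rule ccontr)
  assume contra: "\<not> ?thesis"
  interpret bounded_linear \<phi> by fact
  obtain C where C: "0 < C" "\<And>x. \<bar>\<phi> x\<bar> \<le> norm x * C" using pos_bounded by auto
  obtain m :: nat where m: "(C / e)\<^sup>2 < m" using reals_Archimedean2 by blast
  have m0: "0 < m"
    using m by (metis less_nat_zero_code linorder_neqE_nat not_less_iff_gr_or_eq of_nat_0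
      zero_le_power2 linorder_not_le)
  \<comment> \<open>The parts collect the elements of \<open>N\<close> whose positions in the increasing enumeration are
    congruent modulo \<open>m\<close>.\<close>
  define part where "part i = enumerate N ` {k. k mod m = i}" for i
  have enum_inj: "enumerate N k = enumerate N l \<longleftrightarrow> k = l" for k l
    using strict_mono_enumerate[OF assms(2)] by (simp add: strict_mono_eq)
  have "infinite (part i)" if "i < m" for i
  proof -
    have "inj (\<lambda>k. enumerate N (k * m + i))"
      using m0 by (auto simp: inj_def enum_inj)
    then have "infinite (range (\<lambda>k. enumerate N (k * m + i)))" by (rule range_inj_infinite)
    moreover have "range (\<lambda>k. enumerate N (k * m + i)) \<subseteq> part i"
      unfolding part_def using that by auto
    ultimately show ?thesis using finite_subset by blast
  qed
  moreover have "part i \<subseteq> N" for i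
    unfolding part_def using enumerate_in_set[OF assms(2)] by auto
  ultimately have "\<exists>x. (\<forall>K. coef x K \<noteq> 0 \<longrightarrow> length K \<in> part i) \<and> e * norm x < \<bar>\<phi> x\<bar>" if "i < m" for i
    using contra that by (meson not_le)
  then obtain x where x: "\<And>i K. i < m \<Longrightarrow> coef (x i) K \<noteq> 0 \<Longrightarrow> length K \<in> part i"
      "\<And>i. i < m \<Longrightarrow> e * norm (x i) < \<bar>\<phi> (x i)\<bar>"
    by metis
  have disj: "i = j" if "n \<in> part i" "n \<in> part j" for n i j
    using that unfolding part_def by (auto simp: enum_inj)
  have nz: "0 < norm (x i)" if "i < m" for i
    using x(2)[OF that] by (cases "x i = 0") (auto simp: zero)
  define c where "c i = sgn (\<phi> (x i)) / norm (x i)" for i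
  define y where "y = (\<Sum>i<m. c i *\<^sub>R x i)"
  have n1: "norm (c i *\<^sub>R x i) \<le> 1" if "i < m" for i
    using nz[OF that] by (simp add: c_def abs_sgn_eq)
  have "path_sum (coef y) K \<le> (\<Sum>i<m. path_sum (coef (c i *\<^sub>R x i)) K)" for K
  proof (induction K)
    case (Cons b K)
    have "(coef y K)\<^sup>2 = (\<Sum>i<m. (coef (c i *\<^sub>R x i) K)\<^sup>2)"
      unfolding y_def coef_sum
    proof (rule sq_sum_orthogonal)
      fix i j assume "i \<in> {..<m}" "j \<in> {..<m}" "i \<noteq> j"
      then show "coef (c i *\<^sub>R x i) K = 0 \<or> coef (c j *\<^sub>R x j) K = 0"
        using x(1)[of i K] x(1)[of j K] disj by auto
    qed simp
    then show ?case using Cons by (simp add: sum.distrib)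
  qed simp
  also have "(\<Sum>i<m. path_sum (coef (c i *\<^sub>R x i)) K) \<le> (\<Sum>i<m. 1)" for K
    using n1 by (intro sum_mono order_trans[OF path_sum_le_norm] power_le_one) auto
  finally have "norm y \<le> sqrt m" by (subst norm_le_iff_path_sum) auto
  then have up: "\<phi> y \<le> C * sqrt m"
    using C(2)[of y] C(1) by (smt (verit) mult.commute mult_right_mono)
  have "e \<le> \<phi> (c i *\<^sub>R x i)" if "i < m" for i
    using x(2)[OF that] nz[OF that]
    by (simp add: scaleR c_def field_simps abs_sgn)
  then have "(\<Sum>i<m. e) \<le> (\<Sum>i<m. \<phi> (c i *\<^sub>R x i))" by (intro sum_mono) auto
  then have "m * e \<le> \<phi> y" by (simp add: y_def sum)
  with up have "sqrt m * sqrt m * e \<le> C * sqrt m" by simp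
  then have "sqrt m * e * sqrt m \<le> C * sqrt m" by (simp only: mult.commute mult.left_commute)
  then have "sqrt m * e \<le> C" using m0 by (simp only: mult_le_cancel_right) simp
  then have "sqrt m \<le> C / e" using assms(3) by (simp add: field_simps)
  then have "(sqrt m)\<^sup>2 \<le> (C / e)\<^sup>2" by (intro power_mono) auto
  with m show False by simp
qed

text \<open>The mean of the quadratic form over all choices of signs is its trace. Here the signs are
  chosen one after the other, such that the mixed terms of each new index have a nonnegative sum.\<close>
lemma ex_signs_above_diagonal:
  fixes t :: "'i \<Rightarrow> 'i \<Rightarrow> real"
  assumes "finite S"
  shows "\<exists>s. (\<forall>K. s K = 1 \<or> s K = -1) \<and>
    (\<Sum>K\<in>S. t K K) \<le> (\<Sum>K\<in>S. \<Sum>L\<in>S. s K * (s L * t L K))"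
  using assms
proof (induction S)
  case empty show ?case by (auto intro: exI[of _ "\<lambda>_. 1"])
next
  case (insert x S)
  then obtain s where s: "\<And>K. s K = 1 \<or> s K = -1"
    "(\<Sum>K\<in>S. t K K) \<le> (\<Sum>K\<in>S. \<Sum>L\<in>S. s K * (s L * t L K))" by auto
  let ?r = "(\<Sum>L\<in>S. s L * t L x) + (\<Sum>K\<in>S. s K * t x K)"
  define s' where "s' = s(x := if 0 \<le> ?r then 1 else -1)"
  have s's: "s' K = s K" if "K \<in> S" for K using insert.hyps that by (auto simp: s'_def)
  have xx: "s' x * s' x = 1" by (simp add: s'_def)
  have 1: "(\<Sum>L\<in>S. s' x * (s' L * t L x)) = s' x * (\<Sum>L\<in>S. s L * t L x)"
    unfolding sum_distrib_left by (intro sum.cong) (auto simp: s's mult_ac)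
  have 2: "(\<Sum>K\<in>S. s' K * (s' x * t x K)) = s' x * (\<Sum>K\<in>S. s K * t x K)"
    unfolding sum_distrib_left by (intro sum.cong) (auto simp: s's mult_ac)
  have 3: "(\<Sum>K\<in>S. \<Sum>L\<in>S. s' K * (s' L * t L K)) = (\<Sum>K\<in>S. \<Sum>L\<in>S. s K * (s L * t L K))"
    by (intro sum.cong refl) (auto simp: s's)
  have "(\<Sum>K\<in>insert x S. \<Sum>L\<in>insert x S. s' K * (s' L * t L K))
      = s' x * s' x * t x x + s' x * ?r + (\<Sum>K\<in>S. \<Sum>L\<in>S. s K * (s L * t L K))"
    using insert.hyps by (simp add: sum.distrib 1 2 3) (simp add: algebra_simps)
  moreover have "0 \<le> s' x * ?r" by (simp add: s'_def)
  ultimately have "(\<Sum>K\<in>insert x S. t K K) \<le> (\<Sum>K\<in>insert x S. \<Sum>L\<in>insert x S. s' K * (s' L * t L K))"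
    using insert.hyps s(2) xx by simp
  moreover have "\<forall>K. s' K = 1 \<or> s' K = -1" using s(1) by (simp add: s'_def)
  ultimately show ?case by blast
qed

text \<open>A diagonal argument over the countably many nodes \<open>L\<close>. In terms of the step functions with
  value \<open>\<delta> K\<close> on the interval of \<open>K\<close>, \<open>K\<close> of level \<open>r k\<close>, this is weak* convergence in \<open>L\<^sup>\<infinity>\<close>, and
  \<open>d L\<close> is the mean of the limit over the interval of \<open>L\<close>.\<close>
lemma ex_weak_limit:
  assumes "\<And>K. \<bar>\<delta> K\<bar> \<le> C"
  shows "\<exists>r d. strict_mono (r :: nat \<Rightarrow> nat) \<and> (\<forall>L. (\<lambda>k. avg (descendants {L} (r k)) \<delta>) \<longlonglongrightarrow> d L)"
proof -
  have C0: "0 \<le> C" using assms[of "[]"] by simp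
  have bd: "\<bar>avg S \<delta>\<bar> \<le> C" for S
    using abs_avg_le[of S \<delta>] avg_le_const[of S "\<lambda>K. \<bar>\<delta> K\<bar>" C] assms C0 by force
  interpret subseqs "\<lambda>n s. convergent (\<lambda>k. avg (descendants {from_nat n :: bool list} (s k)) \<delta>)"
  proof
    fix n and s :: "nat \<Rightarrow> nat"
    have "bounded (range (\<lambda>k. avg (descendants {from_nat n :: bool list} (s k)) \<delta>))"
      using bd by (intro boundedI[where B = C]) auto
    from bounded_imp_convergent_subsequence[OF this]
    show "\<exists>r'. strict_mono r'
      \<and> convergent (\<lambda>k. avg (descendants {from_nat n :: bool list} ((s \<circ> r') k)) \<delta>)"
      by (auto simp: convergent_def comp_def)
  qed
  have "convergent (\<lambda>k. avg (descendants {from_nat n :: bool list} (diagseq k)) \<delta>)" for n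
  proof -
    have "convergent (\<lambda>k. avg (descendants {from_nat n :: bool list} ((diagseq \<circ> (+) (Suc n)) k))
      \<delta>)"
    proof (rule diagseq_holds)
      fix r s :: "nat \<Rightarrow> nat" and n
      assume "strict_mono r" "convergent (\<lambda>k. avg (descendants {from_nat n :: bool list} (s k)) \<delta>)"
      from convergent_subseq_convergent[OF this(2,1)]
      show "convergent (\<lambda>k. avg (descendants {from_nat n :: bool list} ((s \<circ> r) k)) \<delta>)"
        by (simp add: comp_def)
    qed
    then have "convergent (\<lambda>k. avg (descendants {from_nat n :: bool list} (diagseq (k + Suc n))) \<delta>)"
      by (simp add: comp_def add.commute)
    then show ?thesis by (rule convergent_ignore_initial_segment[THEN iffD1])
  qed
  note conv = this
  have "\<exists>l. (\<lambda>k. avg (descendants {L} (diagseq k)) \<delta>) \<longlonglongrightarrow> l" for L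
    using conv[of "to_nat L"] unfolding from_nat_to_nat convergent_def .
  then show ?thesis using subseq_diagseq by metis
qed

lemma weak_limit_harmonic:
  assumes "strict_mono (r :: nat \<Rightarrow> nat)" "\<And>L. (\<lambda>k. avg (descendants {L} (r k)) \<delta>) \<longlonglongrightarrow> d L"
  shows "d L = (d (False # L) + d (True # L)) / 2"
proof (rule LIMSEQ_unique[OF assms(2)])
  have "(\<lambda>k. (avg (descendants {False # L} (r k)) \<delta> + avg (descendants {True # L} (r k)) \<delta>) / 2)
     \<longlonglongrightarrow> (d (False # L) + d (True # L)) / 2"
    by (intro tendsto_intros assms(2)) simp
  moreover have "\<forall>\<^sub>F k in sequentially. (avg (descendants {False # L} (r k)) \<delta> + avg (descendants
    {True # L} (r k)) \<delta>) / 2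
     = avg (descendants {L} (r k)) \<delta>"
    using eventually_ge_at_top[of "Suc (length L)"]
  proof eventually_elim
    case (elim k)
    with seq_suble[OF assms(1), of k] have le: "Suc (length L) \<le> r k" by simp
    have sub: "children {L} \<subseteq> level (Suc (length L))" by (auto simp: children_def level_def)
    have "descendants (children {L}) (r k) = descendants {L} (r k)"
    proof -
      have 1: "suffix L K" if "suffix (b # L) K" for b K using that by (rule suffix_ConsD)
      have 2: "suffix (False # L) K \<or> suffix (True # L) K" if K: "suffix L K" "length K = r k" for K
      proof -
        obtain P where P: "K = P @ L" using K(1) by (auto simp: suffix_def)
        with K(2) le have "P \<noteq> []" by auto
        then obtain b P' where "P = P' @ [b]" by (metis rev_exhaust)
        with P show ?thesis by (cases b) (auto simp: suffix_def)
      qed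
      show ?thesis using 1 2 by (auto simp: descendants_def children_def)
    qed
    then have "avg (descendants {L} (r k)) \<delta>
      = avg (children {L}) (\<lambda>L. avg (descendants {L} (r k)) \<delta>)"
      using avg_descendants_split[OF sub le] by metis
    then show ?case by (simp add: avg_children) (simp add: avg_def)
  qed
  ultimately show "(\<lambda>k. avg (descendants {L} (r k)) \<delta>) \<longlonglongrightarrow> (d (False # L) + d (True # L)) / 2"
    by (rule Lim_transform_eventually)
qed

text \<open>This is the orthogonality of martingale differences: the mean of \<open>(d K)\<^sup>2\<close> over level \<open>n\<close>
  equals the value at the root plus the means of the squared half-differences over all earlier
  levels, and it is bounded by \<open>C\<^sup>2\<close>.\<close>
lemma harmonic_differences_null:
  assumes harm: "\<And>L. d L = (d (False # L) + d (True # L)) / 2" and bd: "\<And>L. \<bar>d L\<bar> \<le> C"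
  shows "(\<lambda>n. avg (level n) (\<lambda>K. \<bar>(d (False # K) - d (True # K)) / 2\<bar>)) \<longlonglongrightarrow> 0"
proof (rule level_averages_null)
  fix n
  let ?D = "\<lambda>K. (d (False # K) - d (True # K)) / 2"
  have "avg (level n) (path_sum ?D) + (d [])\<^sup>2 = avg (level n) (\<lambda>K. (d K)\<^sup>2)"
  proof (induction n)
    case 0 show ?case by (simp add: avg_def level_def)
  next
    case (Suc n)
    have "((d (False # K))\<^sup>2 + (d (True # K))\<^sup>2) / 2 = (d K)\<^sup>2 + (?D K)\<^sup>2" for K
      by (subst harm[of K]) (simp add: power2_eq_square field_simps)
    then have "avg (level (Suc n)) (\<lambda>K. (d K)\<^sup>2)
      = avg (level n) (\<lambda>K. (d K)\<^sup>2) + avg (level n) (\<lambda>K. (?D K)\<^sup>2)"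
      by (simp only: avg_level_Suc avg_add)
    with Suc show ?case by (simp only: avg_path_sum_Suc)
  qed
  moreover have "avg (level n) (\<lambda>K. (d K)\<^sup>2) \<le> C\<^sup>2"
    using bd by (intro avg_le_const) (auto simp: abs_le_square_iff[symmetric]
      intro: order_trans[OF _ abs_ge_self])
  ultimately show "avg (level n) (path_sum ?D) \<le> C\<^sup>2" by (smt (verit) zero_le_power2)
qed

section \<open>Choosing the blocks\<close>

text \<open>The blocks are selected in the order of this enumeration, in which parents precede their
  children.\<close>
primrec heap_index :: "bool list \<Rightarrow> nat" where
  "heap_index [] = 0"
| "heap_index (b # K) = Suc (2 * heap_index K + of_bool b)"

lemma heap_index_inj: "heap_index K = heap_index L \<Longrightarrow> K = L"
proof (induction K arbitrary: L)
  case Nil then show ?case by (cases L) auto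
next
  case (Cons b K)
  then obtain c L' where L: "L = c # L'" by (cases L) auto
  have "2 * heap_index K + of_bool b = 2 * heap_index L' + (of_bool c :: nat)" using Cons.prems L
    by simp
  then have "heap_index K = heap_index L' \<and> b = c" by (cases b; cases c) (simp_all, presburger+)
  with Cons.IH L show ?case by blast
qed

lemma heap_index_surj: "\<exists>K. heap_index K = j"
proof (induction j rule: less_induct)
  case (less j)
  show ?case
  proof (cases j)
    case 0 then show ?thesis by (auto intro: exI[of _ "[]"])
  next
    case (Suc i)
    then have "i div 2 < j" by (simp add: le_imp_less_Suc)
    then obtain K where "heap_index K = i div 2" using less by blast
    then have "heap_index (odd i # K) = j" using Suc by simp
    then show ?thesis ..
  qed
qed

definition node :: "nat \<Rightarrow> bool list" where
  "node j = (THE K. heap_index K = j)"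

lemma heap_index_node [simp]: "heap_index (node j) = j"
  unfolding node_def using heap_index_surj heap_index_inj by (metis (mono_tags, lifting) theI')

lemma node_heap_index [simp]: "node (heap_index K) = K"
  by (rule heap_index_inj) simp

lemma heap_index_Cons_gt: "heap_index K < heap_index (b # K)"
  by simp

text \<open>\<open>cells \<nu> J\<close> is the set of the topmost nodes of the region of the tree belonging to \<open>J\<close>, all
  of the same level \<open>entry_level \<nu> J\<close>. It is determined by the values of \<open>\<nu>\<close> at the proper
  ancestors of \<open>J\<close>, so that it is known when the level of \<open>J\<close> has to be chosen.\<close>
primrec cells :: "(bool list \<Rightarrow> nat) \<Rightarrow> bool list \<Rightarrow> bool list set" where
  "cells \<nu> [] = {[]}"
| "cells \<nu> (c # J) = (#) c ` descendants (cells \<nu> J) (\<nu> J)"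

definition block :: "(bool list \<Rightarrow> nat) \<Rightarrow> bool list \<Rightarrow> bool list set" where
  "block \<nu> J = descendants (cells \<nu> J) (\<nu> J)"

fun entry_level :: "(bool list \<Rightarrow> nat) \<Rightarrow> bool list \<Rightarrow> nat" where
  "entry_level \<nu> [] = 0"
| "entry_level \<nu> (c # J) = Suc (\<nu> J)"

lemma cells_cong: "(\<And>I. heap_index I < heap_index J \<Longrightarrow> \<nu> I = \<mu> I) \<Longrightarrow> cells \<nu> J = cells \<mu> J"
proof (induction J)
  case (Cons c J)
  have "cells \<nu> J = cells \<mu> J" using Cons.prems by (intro Cons.IH) auto
  moreover have "\<nu> J = \<mu> J" using Cons.prems by auto
  ultimately show ?case by simp
qed simp

lemma cells_level: "cells \<nu> J \<subseteq> level (entry_level \<nu> J)"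
  by (cases J) (auto simp: level_def descendants_def)

lemma cells_nonempty:
  assumes "\<And>b I. heap_index (b # I) \<le> heap_index J \<Longrightarrow> entry_level \<nu> I \<le> \<nu> I"
  shows "cells \<nu> J \<noteq> {}"
  using assms
proof (induction J)
  case (Cons c J)
  have "cells \<nu> J \<noteq> {}"
  proof (rule Cons.IH)
    fix b I assume "heap_index (b # I) \<le> heap_index J"
    then show "entry_level \<nu> I \<le> \<nu> I" using Cons.prems[of b I] by simp
  qed
  moreover have "entry_level \<nu> J \<le> \<nu> J" using Cons.prems[of c J] by simp
  ultimately have "descendants (cells \<nu> J) (\<nu> J) \<noteq> {}"
    by (intro descendants_nonempty[OF cells_level])
  then show ?case by simp
qed simp

definition signs :: "(bool list \<Rightarrow> real) \<Rightarrow> bool" where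
  "signs s \<longleftrightarrow> (\<forall>K. s K = 1 \<or> s K = -1)"

definition signed_sum :: "bool list set \<Rightarrow> (bool list \<Rightarrow> real) \<Rightarrow> SL_inf" where
  "signed_sum S s = (\<Sum>L\<in>S. s L *\<^sub>R haar_vec L)"

definition signed_avg :: "bool list set \<Rightarrow> (bool list \<Rightarrow> real) \<Rightarrow> SL_inf \<Rightarrow> real" where
  "signed_avg S s x = avg S (\<lambda>K. s K * coef x K)"

lemma signs_abs: "signs s \<Longrightarrow> \<bar>s K\<bar> = 1"
  unfolding signs_def by (metis abs_1 abs_minus_cancel)

lemma signs_sq: "signs s \<Longrightarrow> s K * s K = 1"
  unfolding signs_def by (metis mult_1 mult_minus1 minus_minus)

lemma abs_signed_avg_le_avg: "signs s \<Longrightarrow> \<bar>signed_avg S s x\<bar> \<le> avg S (\<lambda>K. \<bar>coef x K\<bar>)"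
  using abs_avg_le[of S "\<lambda>K. s K * coef x K"] by (simp add: signed_avg_def abs_mult signs_abs)

lemma abs_signed_avg_le_norm: "signs s \<Longrightarrow> \<bar>signed_avg S s x\<bar> \<le> norm x"
  by (rule order_trans[OF abs_signed_avg_le_avg]) (auto intro!: avg_le_const abs_coef_le_norm)

lemma bounded_linear_signed_avg:
  assumes "signs s" shows "bounded_linear (signed_avg S s)"
proof (rule bounded_linear_intro[where K = 1])
  show "signed_avg S s (x + y) = signed_avg S s x + signed_avg S s y" for x y
    by (simp add: signed_avg_def distrib_left avg_add)
  show "signed_avg S s (c *\<^sub>R x) = c *\<^sub>R signed_avg S s x" for c x
    by (simp add: signed_avg_def mult.left_commute avg_cmult)
  show "norm (signed_avg S s x) \<le> norm x * 1" for x
    using abs_signed_avg_le_norm[OF assms] by simp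
qed

text \<open>For each index: the level of the block, its signs, and the infinite set of the levels that
  remain available for later blocks.\<close>
type_synonym selection = "nat \<Rightarrow> nat \<times> (bool list \<Rightarrow> real) \<times> nat set"

text \<open>Here \<open>d\<close> is the weak limit of the diagonal of \<open>T\<close>. The number \<open>\<kappa>\<close> stands for \<open>1\<close> or \<open>-1\<close> and
  tells whether the diagonal entries of the compressed operator are to be bounded from below or
  from above.\<close>
locale diagonal_limit = bounded_linear T for T :: "SL_inf \<Rightarrow> SL_inf" +
  fixes r :: "nat \<Rightarrow> nat" and d :: "bool list \<Rightarrow> real" and \<kappa> :: real
  assumes r_mono: "strict_mono r"
    and d_lim: "\<And>L. (\<lambda>k. avg (descendants {L} (r k)) (\<lambda>K. coef (T (haar_vec K)) K)) \<longlonglongrightarrow> d L"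
begin

definition diag :: "bool list \<Rightarrow> real" where
  "diag K = coef (T (haar_vec K)) K"

definition jump :: "bool list \<Rightarrow> real" where
  "jump K = (d (False # K) - d (True # K)) / 2"

lemma d_harmonic: "d L = (d (False # L) + d (True # L)) / 2"
  using weak_limit_harmonic[OF r_mono d_lim] .

lemma diag_bound: "\<bar>diag K\<bar> \<le> onorm T"
proof -
  have "\<bar>diag K\<bar> \<le> norm (T (haar_vec K))" unfolding diag_def by (rule abs_coef_le_norm)
  also have "\<dots> \<le> onorm T * norm (haar_vec K)" by (rule onorm[OF bounded_linear_axioms])
  also have "\<dots> \<le> onorm T * 1"
    using norm_haar_vec_le onorm_pos_le[OF bounded_linear_axioms] by (intro mult_left_mono)
  finally show ?thesis by simp
qed

lemma d_bound: "\<bar>d L\<bar> \<le> onorm T"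
proof (rule LIMSEQ_le_const2[OF tendsto_rabs[OF d_lim]])
  have "\<bar>avg S diag\<bar> \<le> onorm T" for S
    using order_trans[OF abs_avg_le avg_le_const] diag_bound onorm_pos_le[OF bounded_linear_axioms]
      by blast
  then show "\<exists>N. \<forall>n\<ge>N. \<bar>avg (descendants {L} (r n)) (\<lambda>K. coef (T (haar_vec K)) K)\<bar> \<le> onorm T"
    unfolding diag_def[abs_def] by blast
qed

lemma jump_null: "(\<lambda>n. avg (level n) (\<lambda>K. \<bar>jump K\<bar>)) \<longlonglongrightarrow> 0"
  unfolding jump_def by (rule harmonic_differences_null[OF d_harmonic d_bound])

lemma ex_signs_for_block:
  assumes "finite S"
  shows "\<exists>s. signs s \<and> \<kappa> * avg S diag \<le> \<kappa> * signed_avg S s (T (signed_sum S s))"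
proof -
  obtain s where s: "signs s"
    "(\<Sum>K\<in>S. \<kappa> * coef (T (haar_vec K)) K)
      \<le> (\<Sum>K\<in>S. \<Sum>L\<in>S. s K * (s L * (\<kappa> * coef (T (haar_vec L)) K)))"
    using ex_signs_above_diagonal[OF assms, of "\<lambda>L K. \<kappa> * coef (T (haar_vec L)) K"]
      unfolding signs_def by blast
  have "\<kappa> * signed_avg S s (T (signed_sum S s))
    = (\<Sum>K\<in>S. \<Sum>L\<in>S. s K * (s L * (\<kappa> * coef (T (haar_vec L)) K))) / card S"
    by (simp add: signed_avg_def signed_sum_def sum scaleR avg_def sum_distrib_left mult_ac)
  moreover have "\<kappa> * avg S diag = (\<Sum>K\<in>S. \<kappa> * coef (T (haar_vec K)) K) / card S"
    by (simp add: avg_def diag_def sum_distrib_left)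
  ultimately show ?thesis using s by (auto intro!: exI[of _ s] divide_right_mono)
qed

text \<open>One step of the selection. The vectors \<open>x i\<close> are the images under \<open>T\<close> of the earlier block
  sums. All requirements on \<open>n\<close> hold for every sufficiently large \<open>n\<close> in the range of \<open>r\<close>,
  whatever signs are used afterwards; then the signs are chosen, and finally the levels that
  remain available.\<close>
lemma ex_block:
  fixes x :: "nat \<Rightarrow> SL_inf"
  assumes C: "C \<subseteq> level m" "C \<noteq> {}" and N: "infinite N" "N \<subseteq> range r" "\<And>n. n \<in> N
    \<Longrightarrow> m \<le> n" and "0 < e"
  shows "\<exists>n s N'. n \<in> N \<and> N' \<subseteq> N \<and> infinite N' \<and> (\<forall>k\<in>N'. n < k) \<and> signs s \<and>
    (\<Sum>i<j. avg (descendants C n) (\<lambda>K. \<bar>coef (x i) K\<bar>)) \<le> e \<and>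
    avg (descendants C n) (\<lambda>K. \<bar>jump K\<bar>) \<le> e \<and>
    \<bar>avg (descendants C n) diag - avg C d\<bar> \<le> e \<and>
    \<kappa> * avg (descendants C n) diag
      \<le> \<kappa> * signed_avg (descendants C n) s (T (signed_sum (descendants C n) s)) \<and>
    (\<forall>y. (\<forall>K. coef y K \<noteq> 0 \<longrightarrow> length K \<in> N') \<longrightarrow> \<bar>signed_avg (descendants C n) s (T y)\<bar> \<le> e * norm y)"
proof -
  let ?g = "\<lambda>n. \<Sum>i<j. avg (level n) (\<lambda>K. \<bar>coef (x i) K\<bar>)"
  have "(\<lambda>n. 2 ^ m * ?g n) \<longlonglongrightarrow> 2 ^ m * (\<Sum>i<j. 0)"
    by (intro tendsto_intros level_averages_null_SL)
  then have t1: "(\<lambda>k. 2 ^ m * ?g (r k)) \<longlonglongrightarrow> 0"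
    using LIMSEQ_subseq_LIMSEQ[OF _ r_mono, of "\<lambda>n. 2 ^ m * ?g n"] by (simp add: comp_def)
  have "(\<lambda>n. 2 ^ m * avg (level n) (\<lambda>K. \<bar>jump K\<bar>)) \<longlonglongrightarrow> 2 ^ m * 0"
    by (intro tendsto_intros jump_null)
  then have t2: "(\<lambda>k. 2 ^ m * avg (level (r k)) (\<lambda>K. \<bar>jump K\<bar>)) \<longlonglongrightarrow> 0"
    using LIMSEQ_subseq_LIMSEQ[OF _ r_mono, of "\<lambda>n. 2 ^ m * avg (level n) (\<lambda>K. \<bar>jump K\<bar>)"]
    by (simp add: comp_def)
  have t3: "(\<lambda>k. avg C (\<lambda>L. avg (descendants {L} (r k)) diag)) \<longlonglongrightarrow> avg C d"
    unfolding avg_def[of C] diag_def divide_inverse by (intro tendsto_intros d_lim)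
  have "\<forall>\<^sub>F k in sequentially. 2 ^ m * ?g (r k) < e \<and> 2 ^ m * avg (level (r k)) (\<lambda>K. \<bar>jump K\<bar>) < e \<and>
     dist (avg C (\<lambda>L. avg (descendants {L} (r k)) diag)) (avg C d) < e"
    using order_tendstoD(2)[OF t1 \<open>0 < e\<close>] order_tendstoD(2)[OF t2 \<open>0 < e\<close>] tendstoD[OF t3 \<open>0 < e\<close>]
    by eventually_elim simp
  then obtain k0 where k0: "\<And>k. k0 \<le> k \<Longrightarrow> 2 ^ m * ?g (r k) < e"
      "\<And>k. k0 \<le> k \<Longrightarrow> 2 ^ m * avg (level (r k)) (\<lambda>K. \<bar>jump K\<bar>) < e"
      "\<And>k. k0 \<le> k \<Longrightarrow> dist (avg C (\<lambda>L. avg (descendants {L} (r k)) diag)) (avg C d) < e"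
    unfolding eventually_sequentially by blast
  \<comment> \<open>As \<open>N\<close> is infinite and lies in the range of the increasing \<open>r\<close>, it meets every tail of this
    range.\<close>
  obtain n where n: "n \<in> N" "r k0 \<le> n" using N(1) unfolding infinite_nat_iff_unbounded_le by blast
  then obtain k where k: "n = r k" using N(2) by blast
  then have kk: "k0 \<le> k" using n(2) r_mono by (simp add: strict_mono_less_eq)
  have mn: "m \<le> n" using N(3) n(1) .
  let ?S = "descendants C n"
  obtain s where s: "signs s" "\<kappa> * avg ?S diag \<le> \<kappa> * signed_avg ?S s (T (signed_sum ?S s))"
    using ex_signs_for_block[OF finite_descendants] by blast
  have bl: "bounded_linear (\<lambda>y. signed_avg ?S s (T y))"
    using bounded_linear_compose[OF bounded_linear_signed_avg[OF s(1)] bounded_linear_axioms] .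
  have "N \<subseteq> (N \<inter> {n<..}) \<union> {..n}" by auto
  then have "infinite (N \<inter> {n<..})" using N(1) finite_subset by blast
  from functional_small_on_sparse_levels[OF bl this \<open>0 < e\<close>]
  obtain N' where N': "N' \<subseteq> N \<inter> {n<..}" "infinite N'"
    "\<forall>y. (\<forall>K. coef y K \<noteq> 0 \<longrightarrow> length K \<in> N') \<longrightarrow> \<bar>signed_avg ?S s (T y)\<bar> \<le> e * norm y" by blast
  have "(\<Sum>i<j. avg ?S (\<lambda>K. \<bar>coef (x i) K\<bar>)) \<le> (\<Sum>i<j. 2 ^ m * avg (level n) (\<lambda>K. \<bar>coef (x i) K\<bar>))"
    by (intro sum_mono avg_descendants_le C mn) simp
  then have 1: "(\<Sum>i<j. avg ?S (\<lambda>K. \<bar>coef (x i) K\<bar>)) \<le> e"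
    using k0(1)[OF kk] k by (simp add: sum_distrib_left)
  have "avg ?S (\<lambda>K. \<bar>jump K\<bar>) \<le> 2 ^ m * avg (level n) (\<lambda>K. \<bar>jump K\<bar>)"
    by (intro avg_descendants_le C mn) simp
  then have 2: "avg ?S (\<lambda>K. \<bar>jump K\<bar>) \<le> e" using k0(2)[OF kk] k by simp
  have 3: "\<bar>avg ?S diag - avg C d\<bar> \<le> e"
    using k0(3)[OF kk] unfolding avg_descendants_split[OF C(1) mn] k[symmetric] dist_real_def
      by simp
  show ?thesis
    using n(1) N' s 1 2 3 by (intro exI[of _ n] exI[of _ s] exI[of _ N']) auto
qed

definition levels :: "selection \<Rightarrow> bool list \<Rightarrow> nat" where
  "levels f J = fst (f (heap_index J))"

definition available :: "selection \<Rightarrow> nat \<Rightarrow> nat set" where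
  "available f j = (if j = 0 then range r else snd (snd (f (j - 1))))"

definition block_vec :: "selection \<Rightarrow> nat \<Rightarrow> SL_inf" where
  "block_vec f i =
    signed_sum (descendants (cells (levels f) (node i)) (fst (f i))) (fst (snd (f i)))"

definition admissible :: "(nat \<Rightarrow> real) \<Rightarrow> selection \<Rightarrow> nat \<Rightarrow>
    nat \<times> (bool list \<Rightarrow> real) \<times> nat set \<Rightarrow> bool" where
  "admissible e f j = (\<lambda>(n, s, N').
    let C = cells (levels f) (node j); S = descendants C n; N = available f j in
    n \<in> N \<and> N' \<subseteq> N \<and> infinite N' \<and> (\<forall>k\<in>N'. n < k) \<and> signs s \<and>
    (\<Sum>i<j. avg S (\<lambda>K. \<bar>coef (T (block_vec f i)) K\<bar>)) \<le> e j \<and>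
    avg S (\<lambda>K. \<bar>jump K\<bar>) \<le> e j \<and>
    \<bar>avg S diag - avg C d\<bar> \<le> e j \<and>
    \<kappa> * avg S diag \<le> \<kappa> * signed_avg S s (T (signed_sum S s)) \<and>
    (\<forall>y. (\<forall>K. coef y K \<noteq> 0 \<longrightarrow> length K \<in> N') \<longrightarrow> \<bar>signed_avg S s (T y)\<bar> \<le> e j * norm y))"

lemma available_decreasing:
  assumes "\<And>i. i < j \<Longrightarrow> admissible e f i (f i)"
  shows "infinite (available f j) \<and> available f j \<subseteq> range r \<and>
    (\<forall>i<j. available f j \<subseteq> snd (snd (f i)) \<and> (\<forall>n\<in>available f j. fst (f i) < n))"
  using assms
proof (induction j)
  case 0
  show ?case using range_inj_infinite[OF strict_mono_imp_inj_on[OF r_mono]]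
    by (simp add: available_def)
next
  case (Suc j)
  have IH: "infinite (available f j) \<and> available f j \<subseteq> range r \<and>
    (\<forall>i<j. available f j \<subseteq> snd (snd (f i)) \<and> (\<forall>n\<in>available f j. fst (f i) < n))"
    using Suc.prems by (intro Suc.IH) auto
  obtain n s N' where fj: "f j = (n, s, N')" by (cases "f j")
  have "admissible e f j (n, s, N')" using Suc.prems[of j] fj by simp
  then have g: "N' \<subseteq> available f j" "infinite N'" "\<forall>k\<in>N'. n < k"
    by (auto simp: admissible_def Let_def)
  have av: "available f (Suc j) = N'" by (simp add: available_def fj)
  show ?case unfolding av using IH g fj by (fastforce simp: less_Suc_eq)
qed

lemma entry_level_le_available:
  assumes "\<And>i. i < j \<Longrightarrow> admissible e f i (f i)" "heap_index J \<le> j" "n \<in> available f j"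
  shows "entry_level (levels f) J \<le> n"
proof (cases J)
  case (Cons c I)
  then have "heap_index I < j" using assms(2) by simp
  with available_decreasing[OF assms(1)] assms(3) have "fst (f (heap_index I)) < n" by blast
  then show ?thesis by (simp add: Cons levels_def)
qed simp

lemma level_in_available: "admissible e f j (f j) \<Longrightarrow> fst (f j) \<in> available f j"
  unfolding admissible_def Let_def by (auto split: prod.splits)

lemma ex_admissible_selection:
  assumes "\<And>j. 0 < e j"
  shows "\<exists>f. \<forall>j. admissible e f j (f j)"
proof (rule dependent_wellorder_choice)
  fix q and f g :: selection and j :: nat
  assume eq: "\<And>y. y < j \<Longrightarrow> f y = g y"
  have c: "cells (levels f) (node i) = cells (levels g) (node i)" if "i \<le> j" for i
    using eq that by (intro cells_cong) (auto simp: levels_def)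
  have "available f j = available g j" using eq by (auto simp: available_def)
  moreover have "(\<Sum>i<j. avg S (\<lambda>K. \<bar>coef (T (block_vec f i)) K\<bar>))
    = (\<Sum>i<j. avg S (\<lambda>K. \<bar>coef (T (block_vec g i)) K\<bar>))" for S
    using eq c by (intro sum.cong refl) (simp add: block_vec_def)
  ultimately show "admissible e f j q = admissible e g j q"
    unfolding admissible_def by (simp add: c)
next
  fix j and f :: selection assume *: "\<And>y. y < j \<Longrightarrow> admissible e f y (f y)"
  have ne: "cells (levels f) (node j) \<noteq> {}"
  proof (rule cells_nonempty)
    fix b I assume "heap_index (b # I) \<le> heap_index (node j)"
    then have I: "heap_index I < j" by simp
    have "entry_level (levels f) I \<le> fst (f (heap_index I))"
      using * I by (intro entry_level_le_available[of "heap_index I" e] level_in_available) auto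
    then show "entry_level (levels f) I \<le> levels f I" by (simp add: levels_def)
  qed
  have ge: "entry_level (levels f) (node j) \<le> n" if "n \<in> available f j" for n
    using entry_level_le_available[OF *, of j "node j"] that by simp
  have inf: "infinite (available f j)" and sub: "available f j \<subseteq> range r"
    using available_decreasing[OF *] by blast+
  from ex_block[OF cells_level ne inf sub ge assms[of j], where j = j and x
    = "\<lambda>i. T (block_vec f i)"]
  have "\<exists>n s N'. admissible e f j (n, s, N')" by (simp add: admissible_def Let_def)
  then show "\<exists>q. admissible e f j q" by blast
qed

text \<open>Passing from the cells of \<open>J\<close> to its block does not change the average of the harmonic
  function \<open>d\<close>, and passing from the block to one half of its children changes it by the average
  of \<open>jump\<close>.\<close>
lemma avg_d_cells:
  assumes lev: "\<And>J. entry_level \<nu> J \<le> \<nu> J" and pos: "\<And>j. 0 < e j"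
    and jump: "\<And>J. avg (block \<nu> J) (\<lambda>K. \<bar>jump K\<bar>) \<le> e (heap_index J)"
  shows "\<bar>avg (cells \<nu> J) d - d []\<bar> \<le> (\<Sum>i<heap_index J. e i)"
proof (induction J)
  case Nil show ?case by (simp add: avg_def)
next
  case (Cons c J)
  have "d (c # K) = d K + (if c then -1 else 1) * jump K" for K
    by (subst d_harmonic[of K]) (simp add: jump_def field_simps)
  then have "avg (cells \<nu> (c # J)) d
    = avg (block \<nu> J) d + (if c then -1 else 1) * avg (block \<nu> J) jump"
    unfolding cells.simps block_def[symmetric] avg_Cons_image by (simp only: avg_add avg_cmult)
  moreover have "avg (block \<nu> J) d = avg (cells \<nu> J) d"
    unfolding block_def by (rule avg_descendants_harmonic[OF cells_level lev d_harmonic])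
  moreover have "\<bar>avg (block \<nu> J) jump\<bar> \<le> e (heap_index J)"
    using abs_avg_le jump order_trans by blast
  ultimately have "\<bar>avg (cells \<nu> (c # J)) d - d []\<bar> \<le> (\<Sum>i<heap_index J. e i) + e (heap_index J)"
    using Cons by (cases c) auto
  also have "\<dots> = (\<Sum>i<Suc (heap_index J). e i)" by simp
  also have "\<dots> \<le> (\<Sum>i<heap_index (c # J). e i)"
    using pos by (intro sum_mono2) (auto intro: less_imp_le)
  finally show ?case .
qed

text \<open>The selection, with what was known about it along the way condensed into five properties:
  the order of the levels, the signs, the influence of earlier blocks, the diagonal entries, and
  the influence of all vectors that live on the levels of later blocks.\<close>
theorem ex_blocks:
  assumes pos: "\<And>j. 0 < e j" and total: "\<And>j. (\<Sum>i<j. e i) \<le> \<tau>"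
  shows "\<exists>\<nu> s. (\<forall>I J. heap_index I < heap_index J \<longrightarrow> \<nu> I < \<nu> J) \<and> (\<forall>J. signs (s J)) \<and>
    (\<forall>J. (\<Sum>i<heap_index J. avg (block \<nu> J)
      (\<lambda>K. \<bar>coef (T (signed_sum (block \<nu> (node i)) (s (node i)))) K\<bar>)) \<le> e (heap_index J)) \<and>
    (\<forall>J. \<kappa> * d [] - \<bar>\<kappa>\<bar> * \<tau> \<le> \<kappa> * signed_avg (block \<nu> J) (s J) (T (signed_sum (block \<nu> J) (s J)))) \<and>
    (\<forall>J y. (\<forall>K. coef y K \<noteq> 0 \<longrightarrow> (\<exists>I. heap_index J < heap_index I \<and> length K = \<nu> I)) \<longrightarrow>
       \<bar>signed_avg (block \<nu> J) (s J) (T y)\<bar> \<le> e (heap_index J) * norm y)"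
proof -
  obtain f where admissible: "\<And>j. admissible e f j (f j)"
    using ex_admissible_selection[of e, OF pos] by blast
  define \<nu> where "\<nu> = levels f"
  define s where "s J = fst (snd (f (heap_index J)))" for J
  define N where "N J = snd (snd (f (heap_index J)))" for J
  have f: "f (heap_index J) = (\<nu> J, s J, N J)" for J by (simp add: \<nu>_def levels_def s_def N_def)
  have bv: "block_vec f i = signed_sum (block \<nu> (node i)) (s (node i))" for i
    by (simp add: block_vec_def block_def \<nu>_def levels_def s_def)
  have g: "signs (s J)"
      "(\<Sum>i<heap_index J. avg (block \<nu> J)
        (\<lambda>K. \<bar>coef (T (signed_sum (block \<nu> (node i)) (s (node i)))) K\<bar>)) \<le> e (heap_index J)"
      "avg (block \<nu> J) (\<lambda>K. \<bar>jump K\<bar>) \<le> e (heap_index J)"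
      "\<bar>avg (block \<nu> J) diag - avg (cells \<nu> J) d\<bar> \<le> e (heap_index J)"
      "\<kappa> * avg (block \<nu> J) diag
        \<le> \<kappa> * signed_avg (block \<nu> J) (s J) (T (signed_sum (block \<nu> J) (s J)))"
      "\<forall>y. (\<forall>K. coef y K \<noteq> 0 \<longrightarrow> length K \<in> N J)
        \<longrightarrow> \<bar>signed_avg (block \<nu> J) (s J) (T y)\<bar> \<le> e (heap_index J) * norm y" for J
    using admissible[of "heap_index J"] unfolding f
      by (simp_all add: admissible_def Let_def bv \<nu>_def[symmetric] block_def)
  have inN: "\<nu> J \<in> available f (heap_index J)" for J
    using level_in_available[OF admissible[of "heap_index J"]] f by simp
  have later: "\<nu> J \<in> N I" "\<nu> I < \<nu> J" if "heap_index I < heap_index J" for I J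
    using available_decreasing[of "heap_index J" e f, OF admissible] inN[of J] that f[of I]
    by (metis subsetD snd_conv, metis fst_conv)
  have lev: "entry_level \<nu> J \<le> \<nu> J" for J
    unfolding \<nu>_def by (rule entry_level_le_available[of
      "heap_index J" e f]) (use admissible inN \<nu>_def in auto)
  have "\<kappa> * d [] - \<bar>\<kappa>\<bar> * \<tau> \<le> \<kappa> * signed_avg (block \<nu> J) (s J) (T (signed_sum (block \<nu> J) (s J)))"
    for J
  proof -
    have "\<bar>avg (block \<nu> J) diag - d []\<bar> \<le> (\<Sum>i<heap_index J. e i) + e (heap_index J)"
      using avg_d_cells[OF lev pos g(3), of J] g(4)[of J] by linarith
    also have "\<dots> \<le> \<tau>" using total[of "Suc (heap_index J)"] by simp
    finally have "\<bar>\<kappa>\<bar> * \<bar>avg (block \<nu> J) diag - d []\<bar> \<le> \<bar>\<kappa>\<bar> * \<tau>" by (intro mult_left_mono) auto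
    then have "\<bar>\<kappa> * avg (block \<nu> J) diag - \<kappa> * d []\<bar> \<le> \<bar>\<kappa>\<bar> * \<tau>"
      by (simp add: abs_mult right_diff_distrib flip: abs_mult)
    with g(5)[of J] show ?thesis by linarith
  qed
  moreover have "\<bar>signed_avg (block \<nu> J) (s J) (T y)\<bar> \<le> e (heap_index J) * norm y"
    if "\<forall>K. coef y K \<noteq> 0 \<longrightarrow> (\<exists>I. heap_index J < heap_index I \<and> length K = \<nu> I)" for J y
    using g(6)[of J] that later(1)[of J] by metis
  ultimately show ?thesis using later(2) g(1,2) by blast
qed

end

section \<open>Factorization of the identity\<close>

text \<open>Increasing levels and arbitrary signs already give a norm one embedding with a norm one left
  inverse; the operator \<open>T\<close> enters only in \<open>almost_diagonal\<close>.\<close>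
locale block_system =
  fixes \<nu> :: "bool list \<Rightarrow> nat" and s :: "bool list \<Rightarrow> bool list \<Rightarrow> real"
  assumes increasing: "\<And>I J. heap_index I < heap_index J \<Longrightarrow> \<nu> I < \<nu> J"
    and signs: "\<And>J. signs (s J)"
begin

text \<open>\<open>trace K\<close> is the index of the block whose region contains \<open>K\<close>: on the way from the root to
  \<open>K\<close>, a step is recorded whenever the current node belongs to the block of the steps recorded so
  far.\<close>
primrec trace :: "bool list \<Rightarrow> bool list" where
  "trace [] = []"
| "trace (b # K) = (if length K = \<nu> (trace K) then b # trace K else trace K)"

lemma entry_level_le: "entry_level \<nu> J \<le> \<nu> J"
  by (cases J) (auto intro!: Suc_leI increasing)

lemma trace_below: "length K \<le> \<nu> (trace K) \<and> (\<exists>L\<in>cells \<nu> (trace K). suffix L K)"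
proof (induction K)
  case (Cons b K)
  show ?case
  proof (cases "length K = \<nu> (trace K)")
    case True
    then have "K \<in> descendants (cells \<nu> (trace K)) (\<nu> (trace K))" using Cons
      by (simp add: descendants_def)
    then have "b # K \<in> cells \<nu> (trace (b # K))" using True by simp
    moreover have "\<nu> (trace K) < \<nu> (b # trace K)" by (rule increasing) (rule heap_index_Cons_gt)
    ultimately show ?thesis using True by (intro conjI bexI[of _ "b # K"]) auto
  next
    case False
    with Cons show ?thesis by (auto intro: suffix_ConsI)
  qed
qed simp

lemma trace_above: "L \<in> cells \<nu> J \<Longrightarrow> length (P @ L) \<le> \<nu> J \<Longrightarrow> trace (P @ L) = J"
proof (induction J arbitrary: L P)
  case Nil
  then have L: "L = []" by simp
  show ?case using Nil.prems(2) unfolding L by (induction P) auto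
next
  case (Cons c J)
  obtain M where M: "L = c # M" "M \<in> descendants (cells \<nu> J) (\<nu> J)" using Cons.prems(1) by auto
  then obtain L' P' where "M = P' @ L'" "L' \<in> cells \<nu> J" and len: "length M = \<nu> J"
    by (auto simp: descendants_def suffix_def)
  then have "trace M = J" using Cons.IH[of L' P'] by simp
  then have L: "trace L = c # J" using M len by simp
  show ?case using Cons.prems(2) by (induction P) (auto simp: L)
qed

lemma mem_block_iff: "K \<in> block \<nu> J \<longleftrightarrow> trace K = J \<and> length K = \<nu> J"
proof
  assume "K \<in> block \<nu> J"
  then obtain L P where "K = P @ L" "L \<in> cells \<nu> J" "length K = \<nu> J"
    by (auto simp: block_def descendants_def suffix_def)
  then show "trace K = J \<and> length K = \<nu> J" using trace_above[of L J P] by simp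
next
  assume "trace K = J \<and> length K = \<nu> J"
  then show "K \<in> block \<nu> J" using trace_below[of K] by (auto simp: block_def descendants_def)
qed

lemma finite_block: "finite (block \<nu> J)"
  unfolding block_def by (rule finite_descendants)

lemma block_nonempty: "block \<nu> J \<noteq> {}"
  unfolding block_def by (intro descendants_nonempty[OF cells_level entry_level_le] cells_nonempty
    entry_level_le)

definition embed :: "SL_inf \<Rightarrow> SL_inf" where
  "embed f = of_coef (\<lambda>K. if length K = \<nu> (trace K) then s (trace K) K * coef f (trace K) else 0)"

definition average :: "SL_inf \<Rightarrow> SL_inf" where
  "average f = of_coef (\<lambda>J. signed_avg (block \<nu> J) (s J) f)"

text \<open>Along the path to \<open>K\<close>, the nonzero coefficients of the embedded vector are, up to signs,
  those of \<open>f\<close> along the path to \<open>trace K\<close>. This yields the norm estimate for \<open>embed\<close>.\<close>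
lemma path_sum_embed:
  "path_sum (\<lambda>K. if length K = \<nu> (trace K) then s (trace K) K * coef f (trace K) else 0) K
    = path_sum (coef f) (trace K)"
  by (induction K) (auto simp: power_mult_distrib power2_eq_square[of "s _ _"] signs_sq[OF signs])

lemma coef_embed: "coef (embed f) K = (if length K
  = \<nu> (trace K) then s (trace K) K * coef f (trace K) else 0)"
proof -
  have "path_sum (\<lambda>K.
    if length K = \<nu> (trace K) then s (trace K) K * coef f (trace K) else 0) K \<le> (norm f)\<^sup>2" for K
    unfolding path_sum_embed by (rule path_sum_le_norm)
  from coef_of_coef[OF this] show ?thesis unfolding embed_def by (simp only:)
qed

lemma norm_embed_le: "norm (embed f) \<le> norm f"
  unfolding norm_le_iff_path_sum[OF norm_ge_zero] coef_embed[abs_def] path_sum_embed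
    using path_sum_le_norm by blast

lemma bounded_linear_embed: "bounded_linear embed"
  by (rule bounded_linear_intro[where K = 1])
    (auto intro!: SL_eqI norm_embed_le simp: coef_embed algebra_simps)

text \<open>By the Cauchy-Schwarz inequality the squared average is at most the average of the squares.
  Every member of a block has equally many descendants in the block of each child, so the averages
  of the squares over the blocks along the path to \<open>J\<close> can all be taken over the cells of \<open>J\<close>.\<close>
lemma path_sum_average: "path_sum (\<lambda>J. signed_avg (block \<nu> J) (s J) f) J
  \<le> avg (cells \<nu> J) (path_sum (coef f))"
proof (induction J)
  case (Cons c J)
  have "(signed_avg (block \<nu> J) (s J) f)\<^sup>2 \<le> avg (block \<nu> J) (\<lambda>K. (s J K * coef f K)\<^sup>2)"
    unfolding signed_avg_def by (rule avg_sq_le)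
  also have "\<dots> = avg (block \<nu> J) (\<lambda>K. (coef f K)\<^sup>2)"
    by (simp add: power_mult_distrib power2_eq_square[of "s _ _"] signs_sq[OF signs])
  finally have 1: "(signed_avg (block \<nu> J) (s J) f)\<^sup>2 \<le> avg (block \<nu> J) (\<lambda>K. (coef f K)\<^sup>2)" .
  have 2: "avg (cells \<nu> J) (path_sum (coef f)) \<le> avg (block \<nu> J) (path_sum (coef f))"
    unfolding block_def by (rule avg_descendants_mono[OF cells_level entry_level_le]) simp
  have "avg (cells \<nu> (c # J)) (path_sum (coef f))
    = avg (block \<nu> J) (path_sum (coef f)) + avg (block \<nu> J) (\<lambda>K. (coef f K)\<^sup>2)"
    by (simp add: avg_Cons_image avg_add block_def)
  with Cons 1 2 show ?case by simp
qed (simp add: avg_def)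

lemma path_sum_average_le: "path_sum (\<lambda>J. signed_avg (block \<nu> J) (s J) f) J \<le> (norm f)\<^sup>2"
  by (rule order_trans[OF path_sum_average]) (intro avg_le_const path_sum_le_norm zero_le_power2)

lemma coef_average: "coef (average f) J = signed_avg (block \<nu> J) (s J) f"
  unfolding average_def coef_of_coef[OF path_sum_average_le] ..

lemma norm_average_le: "norm (average f) \<le> norm f"
  unfolding norm_le_iff_path_sum[OF norm_ge_zero] coef_average[abs_def] using path_sum_average_le
    by blast

lemma bounded_linear_average: "bounded_linear average"
proof (rule bounded_linear_intro[where K = 1])
  note lin = bounded_linear.linear[OF bounded_linear_signed_avg[OF signs]]
  show "average (x + y) = average x + average y" for x y
    by (rule SL_eqI) (simp add: coef_average linear_add[OF lin])
  show "average (c *\<^sub>R x) = c *\<^sub>R average x" for c x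
    by (rule SL_eqI) (simp add: coef_average linear_cmul[OF lin])
qed (simp add: norm_average_le)

lemma signed_avg_embed: "signed_avg (block \<nu> J) (s J) (embed f) = coef f J"
proof -
  have "s J K * coef (embed f) K = coef f J" if "K \<in> block \<nu> J" for K
    using that signs_sq[OF signs, of J K] by (simp add: mem_block_iff coef_embed flip: mult.assoc)
  then have "signed_avg (block \<nu> J) (s J) (embed f) = avg (block \<nu> J) (\<lambda>_. coef f J)"
    unfolding signed_avg_def by (rule avg_cong)
  then show ?thesis by (simp add: avg_const finite_block block_nonempty)
qed

lemma average_embed: "average (embed f) = f"
  by (rule SL_eqI) (simp add: coef_average signed_avg_embed)

lemma embed_haar_vec: "embed (haar_vec J) = signed_sum (block \<nu> J) (s J)"
proof (rule SL_eqI)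
  fix K
  have "coef (signed_sum (block \<nu> J) (s J)) K = (\<Sum>L\<in>block \<nu> J. if K = L then s J L else 0)"
    by (auto simp: signed_sum_def intro!: sum.cong)
  also have "\<dots> = (if K \<in> block \<nu> J then s J K else 0)" using finite_block by simp
  finally show "coef (embed (haar_vec J)) K = coef (signed_sum (block \<nu> J) (s J)) K"
    by (auto simp: coef_embed mem_block_iff)
qed

text \<open>Write \<open>x\<close> as a combination of the Haar functions with index up to that of \<open>J\<close> and a tail.
  The terms before \<open>J\<close> are controlled by the assumption on earlier blocks, the term of \<open>J\<close> is the
  diagonal one, and the tail is embedded into levels chosen after that of \<open>J\<close>, so that the
  assumption on later blocks applies.\<close>
lemma almost_diagonal:
  fixes T :: "SL_inf \<Rightarrow> SL_inf"
  assumes T: "bounded_linear T"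
    and earlier: "\<And>J. (\<Sum>i<heap_index J. avg (block \<nu> J)
      (\<lambda>K. \<bar>coef (T (signed_sum (block \<nu> (node i)) (s (node i)))) K\<bar>)) \<le> e (heap_index J)"
    and later: "\<And>J y. (\<forall>K. coef y K \<noteq> 0 \<longrightarrow> (\<exists>I. heap_index J < heap_index I \<and> length K = \<nu> I)) \<Longrightarrow>
       \<bar>signed_avg (block \<nu> J) (s J) (T y)\<bar> \<le> e (heap_index J) * norm y"
  shows "\<bar>signed_avg (block \<nu> J) (s J) (T (embed x)) - signed_avg (block \<nu> J) (s J) (T (signed_sum
    (block \<nu> J) (s J))) * coef x J\<bar>
    \<le> 2 * e (heap_index J) * norm x"
proof -
  let ?j = "heap_index J"
  define \<phi> where "\<phi> y = signed_avg (block \<nu> J) (s J) (T (embed y))" for y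
  have lin: "linear \<phi>"
    unfolding \<phi>_def
    by (intro bounded_linear.linear bounded_linear_compose[OF bounded_linear_signed_avg[OF signs]]
        bounded_linear_compose[OF T] bounded_linear_embed)
  define tail where "tail = x - (\<Sum>i\<le>?j. coef x (node i) *\<^sub>R haar_vec (node i))"
  have "(\<Sum>i\<le>?j. coef x (node i) * of_bool (K = node i)) = (\<Sum>i\<le>?j.
    if i = heap_index K then coef x (node i) else 0)" for K
    by (intro sum.cong) (auto)
  then have coef_tail: "coef tail K = (if heap_index K \<le> ?j then 0 else coef x K)" for K
    unfolding tail_def by (auto simp: )
  have "norm tail \<le> norm x"
    unfolding norm_le_iff_path_sum[OF norm_ge_zero]
    using order_trans[OF path_sum_cong_le[of "coef tail" "coef x"] path_sum_le_norm]
      by (simp add: coef_tail)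
  then have nt: "norm (embed tail) \<le> norm x" using norm_embed_le order_trans by blast
  have e0: "0 \<le> e ?j" by (rule order_trans[OF _ earlier]) (intro sum_nonneg avg_nonneg abs_ge_zero)
  have "\<bar>\<phi> tail\<bar> \<le> e ?j * norm (embed tail)"
    unfolding \<phi>_def
  proof (rule later, intro allI impI)
    fix K assume "coef (embed tail) K \<noteq> 0"
    then have "length K = \<nu> (trace K)" "?j < heap_index (trace K)"
      by (auto simp: coef_embed coef_tail split: if_splits)
    then show "\<exists>I. ?j < heap_index I \<and> length K = \<nu> I" by blast
  qed
  also have "\<dots> \<le> e ?j * norm x" using nt e0 by (rule mult_left_mono)
  finally have t: "\<bar>\<phi> tail\<bar> \<le> e ?j * norm x" .
  have "\<bar>\<Sum>i<?j. coef x (node i) * \<phi> (haar_vec (node i))\<bar>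
      \<le> (\<Sum>i<?j. norm x * avg (block \<nu> J)
        (\<lambda>K. \<bar>coef (T (signed_sum (block \<nu> (node i)) (s (node i)))) K\<bar>))"
    unfolding \<phi>_def embed_haar_vec
    by (rule order_trans[OF sum_abs])
      (auto simp: abs_mult intro!: sum_mono mult_mono abs_coef_le_norm abs_signed_avg_le_avg signs)
  also have "\<dots> \<le> norm x * e ?j" unfolding sum_distrib_left[symmetric]
    by (intro mult_left_mono earlier) simp
  finally have h: "\<bar>\<Sum>i<?j. coef x (node i) * \<phi> (haar_vec (node i))\<bar> \<le> e ?j * norm x"
    by (simp add: mult.commute)
  have "\<phi> x = \<phi> ((\<Sum>i\<le>?j. coef x (node i) *\<^sub>R haar_vec (node i)) + tail)" by (simp add: tail_def)
  also have "\<dots> = (\<Sum>i\<le>?j. coef x (node i) * \<phi> (haar_vec (node i))) + \<phi> tail"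
    by (simp only: linear_add[OF lin] linear_sum[OF lin] linear_cmul[OF lin] real_scaleR_def)
  also have "(\<Sum>i\<le>?j. coef x (node i) * \<phi> (haar_vec (node i)))
      = (\<Sum>i<?j. coef x (node i) * \<phi> (haar_vec (node i))) + coef x J * \<phi> (haar_vec J)"
    by (simp add: lessThan_Suc_atMost[symmetric])
  finally have "\<bar>\<phi> x - \<phi> (haar_vec J) * coef x J\<bar> \<le> 2 * e ?j * norm x"
    using t h by (simp add: mult.commute) 
  then show ?thesis by (simp add: \<phi>_def embed_haar_vec)
qed

end

text \<open>With \<open>D\<close> the division by the \<open>\<theta> J\<close> and \<open>E\<close> the error, \<open>M x = y\<close> is the fixed point equation
  \<open>D (y - E x) = x\<close>, and \<open>D \<circ> E\<close> has norm at most \<open>\<rho> / g < 1\<close>.\<close>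
lemma almost_diagonal_left_inverse:
  fixes M :: "SL_inf \<Rightarrow> SL_inf"
  assumes M: "bounded_linear M"
    and \<theta>: "\<And>J. g \<le> \<theta> J"
    and err: "\<And>x J. \<bar>coef (M x) J - \<theta> J * coef x J\<bar> \<le> \<epsilon> J * norm x"
    and sq: "\<And>K. path_sum \<epsilon> K \<le> \<rho>\<^sup>2" and \<rho>: "0 \<le> \<rho>" "\<rho> < g"
  shows "\<exists>V. bounded_linear V \<and> V \<circ> M = id \<and> (\<forall>y. norm (V y) \<le> norm y / (g - \<rho>))"
proof -
  interpret M: bounded_linear M by fact
  have g0: "0 < g" using \<rho> by simp
  have th0: "0 < \<theta> J" for J using \<theta>[of J] g0 by simp
  define E where "E x = of_coef (\<lambda>J. coef (M x) J - \<theta> J * coef x J)" for x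
  define D where "D y = of_coef (\<lambda>J. coef y J / \<theta> J)" for y
  have pc: "path_sum (\<lambda>J. c * a J) K = c\<^sup>2 * path_sum a K" for c a K
    by (induction K) (auto simp: power_mult_distrib distrib_left)
  have pE: "path_sum (\<lambda>J. coef (M x) J - \<theta> J * coef x J) K \<le> (\<rho> * norm x)\<^sup>2" for x K
  proof -
    have "path_sum (\<lambda>J. coef (M x) J - \<theta> J * coef x J) K \<le> path_sum (\<lambda>J. norm x * \<epsilon> J) K"
      using order_trans[OF err abs_ge_self] by (intro path_sum_cong_le) (simp add: mult.commute)
    also have "\<dots> \<le> (norm x)\<^sup>2 * \<rho>\<^sup>2" unfolding pc by (intro mult_left_mono sq) simp
    finally show ?thesis by (simp add: power_mult_distrib mult.commute)
  qed
  have coef_E: "coef (E x) J = coef (M x) J - \<theta> J * coef x J" for x J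
    unfolding E_def coef_of_coef[OF pE] ..
  have norm_E: "norm (E x) \<le> \<rho> * norm x" for x
    using pE \<rho>(1) by (subst norm_le_iff_path_sum) (auto simp: coef_E[abs_def])
  have pD: "path_sum (\<lambda>J. coef y J / \<theta> J) K \<le> (norm y / g)\<^sup>2" for y K
  proof -
    have "path_sum (\<lambda>J. coef y J / \<theta> J) K \<le> path_sum (\<lambda>J. inverse g * coef y J) K"
    proof (rule path_sum_cong_le)
      fix J
      have "\<bar>coef y J\<bar> / \<theta> J \<le> \<bar>coef y J\<bar> / g" using \<theta>[of J] g0 th0[of J]
        by (intro divide_left_mono) auto
      then show "\<bar>coef y J / \<theta> J\<bar> \<le> \<bar>inverse g * coef y J\<bar>"
        using g0 th0[of J] by (simp add: abs_mult divide_inverse mult.commute)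
    qed
    also have "\<dots> \<le> (inverse g)\<^sup>2 * (norm y)\<^sup>2" unfolding pc
      by (intro mult_left_mono path_sum_le_norm) simp
    finally show ?thesis by (simp add: divide_inverse power_mult_distrib mult.commute)
  qed
  have coef_D: "coef (D y) J = coef y J / \<theta> J" for y J
    unfolding D_def coef_of_coef[OF pD] ..
  have norm_D: "norm (D y) \<le> norm y / g" for y
    using pD g0 by (subst norm_le_iff_path_sum) (auto simp: coef_D[abs_def])
  \<comment> \<open>Since \<open>E x\<close> contains \<open>M x\<close> and the diagonal part, dividing \<open>y - E x\<close> by \<open>\<theta>\<close> returns \<open>x\<close>
    exactly if \<open>M x = y\<close>.\<close>
  have fix_iff: "D (y - E x) = x \<longleftrightarrow> M x = y" for x y
  proof
    assume *: "D (y - E x) = x"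
    show "M x = y"
    proof (rule SL_eqI)
      fix J
      have "coef x J = (coef y J - (coef (M x) J - \<theta> J * coef x J)) / \<theta> J"
        using arg_cong[OF *, of "\<lambda>f. coef f J"] by (simp add: coef_D coef_E)
      then show "coef (M x) J = coef y J" using th0[of J] by (simp add: field_simps)
    qed
  next
    assume "M x = y"
    then show "D (y - E x) = x" using th0
      by (intro SL_eqI) (simp add: coef_D coef_E less_imp_neq[symmetric])
  qed
  have "\<exists>x. M x = y" for y
  proof -
    have "dist (D (y - E u)) (D (y - E v)) \<le> (\<rho> / g) * dist u v" for u v
    proof -
      have "D (y - E u) - D (y - E v) = D (E (v - u))"
        using th0 by (intro SL_eqI)
          (simp add: coef_D coef_E M.diff less_imp_neq[symmetric] field_simps)
      then have "dist (D (y - E u)) (D (y - E v)) \<le> norm (E (v - u)) / g"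
        using norm_D by (simp add: dist_norm)
      also have "\<dots> \<le> \<rho> * norm (v - u) / g" using norm_E g0 by (intro divide_right_mono) auto
      finally show ?thesis by (simp add: dist_norm norm_minus_commute)
    qed
    then have "\<exists>!x. D (y - E x) = x"
      using \<rho> g0 by (intro banach_fix_type[where c = "\<rho> / g"]) auto
    then show ?thesis using fix_iff by blast
  qed
  then have surj: "surj M" by (metis surjI)
  have low: "norm x \<le> norm (M x) / (g - \<rho>)" for x
  proof -
    have "x = D (M x - E x)" using fix_iff[of "M x" x] by simp
    then have "norm x \<le> norm (M x - E x) / g" using norm_D by metis
    also have "\<dots> \<le> (norm (M x) + \<rho> * norm x) / g"
      using norm_triangle_ineq4[of "M x" "E x"] norm_E[of x] g0 by (intro divide_right_mono) auto
    finally show ?thesis using g0 \<rho> by (simp add: field_simps)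
  qed
  have inj: "inj M"
  proof (rule injI)
    fix x y assume "M x = M y"
    then show "x = y" using low[of "x - y"] by (simp add: M.diff)
  qed
  have MV: "M (inv M y) = y" for y using surj by (rule surj_f_inv_f)
  have VM: "inv M (M x) = x" for x using inj by (rule inv_f_f)
  have nV: "norm (inv M y) \<le> norm y / (g - \<rho>)" for y using low[of "inv M y"] by (simp add: MV)
  have "bounded_linear (inv M)"
  proof (rule bounded_linear_intro[where K = "1 / (g - \<rho>)"])
    show "inv M (x + y) = inv M x + inv M y" for x y
      using VM[of "inv M x + inv M y"] by (simp add: M.add MV)
    show "inv M (c *\<^sub>R x) = c *\<^sub>R inv M x" for c x
      using VM[of "c *\<^sub>R inv M x"] by (simp add: M.scaleR MV)
  qed (use nV in simp)
  with nV VM show ?thesis by (intro exI[of _ "inv M"]) auto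
qed

lemma path_sum_le_sum_sq:
  assumes "\<And>j. 0 \<le> e j"
  shows "path_sum (\<lambda>J. e (heap_index J)) K \<le> (\<Sum>i<heap_index K. e i)\<^sup>2"
proof (induction K)
  case (Cons b K)
  let ?S = "\<Sum>i<heap_index K. e i"
  have S: "0 \<le> ?S" using assms by (simp add: sum_nonneg)
  have "path_sum (\<lambda>J. e (heap_index J)) (b # K) \<le> ?S\<^sup>2 + (e (heap_index K))\<^sup>2" using Cons by simp
  also have "\<dots> \<le> (?S + e (heap_index K))\<^sup>2" using S assms[of "heap_index K"]
    by (simp add: power2_sum)
  also have "?S + e (heap_index K) = (\<Sum>i<Suc (heap_index K). e i)" by simp
  also have "(\<Sum>i<Suc (heap_index K). e i)\<^sup>2 \<le> (\<Sum>i<heap_index (b # K). e i)\<^sup>2"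
    using assms by (intro power_mono sum_mono2) (auto simp: sum_nonneg)
  finally show ?case .
qed simp

text \<open>The compression of \<open>Id - T\<close> to the blocks is the identity minus the compression of \<open>T\<close>, so
  that both alternatives are covered by one selection of blocks.\<close>
theorem factorization:
  fixes T :: "SL_inf \<Rightarrow> SL_inf"
  assumes T: "bounded_linear T" and "0 < \<eta>"
  shows "\<exists>H \<in> {T, (\<lambda>f. f - T f)}. \<exists>R S :: SL_inf \<Rightarrow> SL_inf.
    bounded_linear R \<and> bounded_linear S \<and> S \<circ> H \<circ> R = id \<and> onorm R * onorm S \<le> 2 + \<eta>"
proof -
  interpret T: bounded_linear T by fact
  \<comment> \<open>The diagonal entries will be at least \<open>1/2 - \<tau>\<close> and the error has norm at most \<open>2 * \<tau>\<close>; this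
    \<open>\<tau>\<close> makes the bound \<open>1 / (1/2 - 3 * \<tau>)\<close> for the inverse at most \<open>2 + \<eta>\<close>.\<close>
  define \<tau> where "\<tau> = \<eta> / (6 * (2 + \<eta>))"
  have \<tau>: "0 < \<tau>" "3 * \<tau> < 1 / 2" "1 / (1 / 2 - \<tau> - 2 * \<tau>) \<le> 2 + \<eta>"
    using assms(2) by (auto simp: \<tau>_def field_simps)
  define e where "e j = \<tau> / 2 ^ Suc j" for j
  have e: "0 < e j" for j using \<tau>(1) by (simp add: e_def)
  have "(\<Sum>i<j. e i) = \<tau> - \<tau> / 2 ^ j" for j
    by (induction j) (auto simp: e_def field_simps)
  then have total: "(\<Sum>i<j. e i) \<le> \<tau>" for j using \<tau>(1) by simp
  have bd: "\<bar>coef (T (haar_vec K)) K\<bar> \<le> onorm T" for K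
  proof -
    have "\<bar>coef (T (haar_vec K)) K\<bar> \<le> onorm T * norm (haar_vec K)"
      by (rule order_trans[OF abs_coef_le_norm onorm[OF T]])
    also have "\<dots> \<le> onorm T * 1" using norm_haar_vec_le onorm_pos_le[OF T] by (intro mult_left_mono)
    finally show ?thesis by simp
  qed
  obtain r d where rd: "strict_mono (r :: nat \<Rightarrow> nat)"
      "\<And>L. (\<lambda>k. avg (descendants {L} (r k)) (\<lambda>K. coef (T (haar_vec K)) K)) \<longlonglongrightarrow> d L"
    using ex_weak_limit[of "\<lambda>K. coef (T (haar_vec K)) K", OF bd] by blast
  \<comment> \<open>This is the place where the choice between \<open>T\<close> and \<open>Id - T\<close> is made.\<close>
  define \<kappa> :: real where "\<kappa> = (if 1 / 2 \<le> d [] then 1 else -1)"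
  interpret diagonal_limit T r d \<kappa> by unfold_locales (fact rd)+
  obtain \<nu> s where blocks:
    "\<And>I J. heap_index I < heap_index J \<Longrightarrow> \<nu> I < \<nu> J" "\<And>J. signs (s J)"
    "\<And>J. (\<Sum>i<heap_index J. avg (block \<nu> J)
      (\<lambda>K. \<bar>coef (T (signed_sum (block \<nu> (node i)) (s (node i)))) K\<bar>)) \<le> e (heap_index J)"
    "\<And>J. \<kappa> * d [] - \<bar>\<kappa>\<bar> * \<tau> \<le> \<kappa> * signed_avg (block \<nu> J) (s J) (T (signed_sum (block \<nu> J) (s J)))"
    "\<And>J y. (\<forall>K. coef y K \<noteq> 0 \<longrightarrow> (\<exists>I. heap_index J < heap_index I \<and> length K = \<nu> I)) \<Longrightarrow>
       \<bar>signed_avg (block \<nu> J) (s J) (T y)\<bar> \<le> e (heap_index J) * norm y"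
    using ex_blocks[of e, OF e total] by blast
  interpret block_system \<nu> s by unfold_locales (fact blocks)+
  define \<theta> where "\<theta> J = signed_avg (block \<nu> J) (s J) (T (signed_sum (block \<nu> J) (s J)))" for J
  have near: "\<bar>coef (average (T (embed x))) J - \<theta> J * coef x J\<bar> \<le> 2 * e (heap_index J) * norm x"
    for x J
    unfolding coef_average \<theta>_def by (rule almost_diagonal[OF T blocks(3,5)])
  obtain H \<theta>' where H: "H \<in> {T, (\<lambda>f. f - T f)}" "bounded_linear H" "\<And>J. 1 / 2 - \<tau> \<le> \<theta>' J"
    "\<And>x J. \<bar>coef (average (H (embed x))) J - \<theta>' J * coef x J\<bar> \<le> 2 * e (heap_index J) * norm x"
  proof (cases "1 / 2 \<le> d []")
    case True
    have "1 / 2 - \<tau> \<le> \<theta> J" for J using blocks(4)[of J] True by (simp add: \<kappa>_def \<theta>_def)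
    then show ?thesis using that[of T \<theta>] T near by blast
  next
    case False
    have 1: "1 / 2 - \<tau> \<le> 1 - \<theta> J" for J using blocks(4)[of J] False by (simp add: \<kappa>_def \<theta>_def)
    have "average (embed x - T (embed x)) = x - average (T (embed x))" for x
      by (simp add: linear_diff[OF bounded_linear.linear[OF bounded_linear_average]] average_embed)
    then have 2: "\<bar>coef (average (embed x - T (embed x))) J - (1 - \<theta> J) * coef x J\<bar>
      \<le> 2 * e (heap_index J) * norm x" for x J
      using near[of x J] by (simp add: left_diff_distrib abs_minus_commute)
    have 3: "bounded_linear (\<lambda>f. f - T f)" by (intro bounded_linear_sub bounded_linear_ident T)
    show ?thesis using that[of "\<lambda>f. f - T f" "\<lambda>J. 1 - \<theta> J"] 1 2 3 by simp
  qed
  define M where "M x = average (H (embed x))" for x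
  have blM: "bounded_linear M"
    unfolding M_def
    by (intro bounded_linear_compose[OF bounded_linear_average] bounded_linear_compose[OF H(2)]
      bounded_linear_embed)
  have sq: "path_sum (\<lambda>J. 2 * e (heap_index J)) K \<le> (2 * \<tau>)\<^sup>2" for K
  proof -
    have "path_sum (\<lambda>J. 2 * e (heap_index J)) K \<le> (\<Sum>i<heap_index K. 2 * e i)\<^sup>2"
      using path_sum_le_sum_sq[of "\<lambda>j. 2 * e j" K] e by (simp add: less_imp_le)
    also have "\<dots> \<le> (2 * \<tau>)\<^sup>2"
      using total[of "heap_index K"] e
        by (intro power_mono) (auto simp: less_imp_le sum_nonneg simp flip: sum_distrib_left)
    finally show ?thesis .
  qed
  have "\<exists>V. bounded_linear V \<and> V \<circ> M = id \<and> (\<forall>y. norm (V y) \<le> norm y / (1 / 2 - \<tau> - 2 * \<tau>))"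
    by (rule almost_diagonal_left_inverse[OF blM H(3) H(4)[folded M_def] sq]) (use \<tau> in auto)
  then obtain V where V: "bounded_linear V" "V \<circ> M = id" "\<And>y. norm (V y)
    \<le> norm y / (1 / 2 - \<tau> - 2 * \<tau>)"
    by blast
  have blS: "bounded_linear (V \<circ> average)"
    unfolding comp_def by (rule bounded_linear_compose[OF V(1) bounded_linear_average])
  have "norm (V (average y)) \<le> (2 + \<eta>) * norm y" for y
  proof -
    have "norm (V (average y)) \<le> (1 / (1 / 2 - \<tau> - 2 * \<tau>)) * norm (average y)"
      using V(3)[of "average y"] by simp
    also have "\<dots> \<le> (2 + \<eta>) * norm y" using \<tau> norm_average_le assms(2) by (intro mult_mono) auto
    finally show ?thesis .
  qed
  then have "onorm (V \<circ> average) \<le> 2 + \<eta>" by (intro onorm_bound) (use assms(2) in auto)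
  moreover have "onorm embed \<le> 1" using norm_embed_le by (intro onorm_bound) auto
  ultimately have "onorm embed * onorm (V \<circ> average) \<le> 1 * (2 + \<eta>)"
    using onorm_pos_le[OF blS] by (intro mult_mono) auto
  moreover have "V \<circ> average \<circ> H \<circ> embed = id" using V(2) by (simp add: fun_eq_iff M_def)
  ultimately show ?thesis using H(1) bounded_linear_embed blS by (intro bexI[OF _ H(1)]) auto
qed

section \<open>Primariness\<close>

definition linear_on_set :: "'a::real_vector set \<Rightarrow> ('a \<Rightarrow> 'b::real_vector) \<Rightarrow> bool" where
  "linear_on_set U f \<longleftrightarrow>
     (\<forall>x\<in>U. \<forall>y\<in>U. f (x + y) = f x + f y) \<and> (\<forall>r. \<forall>x\<in>U. f (r *\<^sub>R x) = r *\<^sub>R f x)"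

text \<open>The inverse is part of the data and linear as well, which makes the relation symmetric and
  transitive on arbitrary sets.\<close>
definition lin_iso :: "'a::real_normed_vector set \<Rightarrow> 'b::real_normed_vector set \<Rightarrow> bool" (infix
  "\<cong>" 50) where
  "U \<cong> V \<longleftrightarrow> (\<exists>f g C. 0 \<le> C \<and> linear_on_set U f \<and> linear_on_set V g \<and>
     (\<forall>x\<in>U. f x \<in> V \<and> g (f x) = x \<and> norm (f x) \<le> C * norm x) \<and>
     (\<forall>y\<in>V. g y \<in> U \<and> f (g y) = y \<and> norm (g y) \<le> C * norm y))"

lemma lin_isoI:
  assumes "linear_on_set U f" "linear_on_set V g"
    "\<And>x. x \<in> U \<Longrightarrow> f x \<in> V" "\<And>x. x \<in> U \<Longrightarrow> g (f x) = x" "\<And>x. x \<in> U \<Longrightarrow> norm (f x) \<le> C * norm x"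
    "\<And>y. y \<in> V \<Longrightarrow> g y \<in> U" "\<And>y. y \<in> V \<Longrightarrow> f (g y) = y" "\<And>y. y \<in> V \<Longrightarrow> norm (g y) \<le> D * norm y"
  shows "U \<cong> V"
proof -
  let ?m = "max 0 (max C D)"
  have "norm (f x) \<le> ?m * norm x" if "x \<in> U" for x
    by (rule order_trans[OF assms(5)[OF that]]) (intro mult_right_mono, auto)
  moreover have "norm (g y) \<le> ?m * norm y" if "y \<in> V" for y
    by (rule order_trans[OF assms(8)[OF that]]) (intro mult_right_mono, auto)
  ultimately show ?thesis
    unfolding lin_iso_def using assms
    by (intro exI[of _ f] exI[of _ g] exI[of _ ?m]) auto
qed

lemma lin_iso_sym: "U \<cong> V \<Longrightarrow> V \<cong> U"
  unfolding lin_iso_def by blast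

lemma lin_iso_refl: "U \<cong> U"
  by (rule lin_isoI[where f = id and g = id and C = 1 and D = 1]) (auto simp: linear_on_set_def)

lemma lin_iso_trans:
  assumes "U \<cong> V" "V \<cong> W" shows "U \<cong> W"
proof -
  obtain f g C where 1: "0 \<le> C" "linear_on_set U f" "linear_on_set V g"
     "\<And>x. x \<in> U \<Longrightarrow> f x \<in> V \<and> g (f x) = x \<and> norm (f x) \<le> C * norm x"
     "\<And>y. y \<in> V \<Longrightarrow> g y \<in> U \<and> f (g y) = y \<and> norm (g y) \<le> C * norm y"
    using assms(1) unfolding lin_iso_def by blast
  obtain f' g' C' where 2: "0 \<le> C'" "linear_on_set V f'" "linear_on_set W g'"
     "\<And>x. x \<in> V \<Longrightarrow> f' x \<in> W \<and> g' (f' x) = x \<and> norm (f' x) \<le> C' * norm x"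
     "\<And>y. y \<in> W \<Longrightarrow> g' y \<in> V \<and> f' (g' y) = y \<and> norm (g' y) \<le> C' * norm y"
    using assms(2) unfolding lin_iso_def by blast
  show ?thesis
  proof (rule lin_isoI[where f = "\<lambda>x. f' (f x)" and g = "\<lambda>y. g (g' y)" and C = "C' * C" and D
    = "C * C'"])
    show "linear_on_set U (\<lambda>x. f' (f x))" "linear_on_set W (\<lambda>y. g (g' y))"
      using 1 2 unfolding linear_on_set_def by metis+
    show "norm (f' (f x)) \<le> C' * C * norm x" if "x \<in> U" for x
    proof -
      have "norm (f' (f x)) \<le> C' * norm (f x)" using 1 2 that by blast
      also have "\<dots> \<le> C' * (C * norm x)" using 1 2 that by (intro mult_left_mono) auto
      finally show ?thesis by simp
    qed
    show "norm (g (g' x)) \<le> C * C' * norm x" if "x \<in> W" for x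
    proof -
      have "norm (g (g' x)) \<le> C * norm (g' x)" using 1 2 that by blast
      also have "\<dots> \<le> C * (C' * norm x)" using 1 2 that by (intro mult_left_mono) auto
      finally show ?thesis by simp
    qed
  qed (use 1 2 in auto)
qed

lemma norm_Pair_le_sum:
  assumes "norm u \<le> C * norm x" "norm v \<le> D * norm y" "0 \<le> C" "0 \<le> D"
  shows "norm (u, v) \<le> (C + D) * norm (x, y)"
proof -
  have "norm (u, v) \<le> norm u + norm v" by (rule norm_Pair_le)
  also have "\<dots> \<le> C * norm (x, y) + D * norm (x, y)"
    using assms norm_fst_le[of x y] norm_snd_le[of y x]
    by (intro add_mono) (meson mult_left_mono order_trans)+
  finally show ?thesis by (simp add: distrib_right)
qed

lemma lin_iso_Times:
  assumes "U \<cong> U'" "V \<cong> V'" shows "U \<times> V \<cong> U' \<times> V'"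
proof -
  obtain f g C where 1: "0 \<le> C" "linear_on_set U f" "linear_on_set U' g"
     "\<And>x. x \<in> U \<Longrightarrow> f x \<in> U' \<and> g (f x) = x \<and> norm (f x) \<le> C * norm x"
     "\<And>y. y \<in> U' \<Longrightarrow> g y \<in> U \<and> f (g y) = y \<and> norm (g y) \<le> C * norm y"
    using assms(1) unfolding lin_iso_def by blast
  obtain f' g' C' where 2: "0 \<le> C'" "linear_on_set V f'" "linear_on_set V' g'"
     "\<And>x. x \<in> V \<Longrightarrow> f' x \<in> V' \<and> g' (f' x) = x \<and> norm (f' x) \<le> C' * norm x"
     "\<And>y. y \<in> V' \<Longrightarrow> g' y \<in> V \<and> f' (g' y) = y \<and> norm (g' y) \<le> C' * norm y"
    using assms(2) unfolding lin_iso_def by blast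
  show ?thesis
  proof (rule lin_isoI[where f = "\<lambda>(x, y). (f x, f' y)" and g = "\<lambda>(x, y). (g x, g' y)"
        and C = "C + C'" and D = "C + C'"])
    show "linear_on_set (U \<times> V) (\<lambda>(x, y). (f x, f' y))"
      "linear_on_set (U' \<times> V') (\<lambda>(x, y). (g x, g' y))"
      using 1 2 by (auto simp: linear_on_set_def)
  qed (use 1 2 in \<open>auto intro!: norm_Pair_le_sum\<close>)
qed

lemma lin_iso_Times_commute: "U \<times> V \<cong> V \<times> U"
proof (rule lin_isoI[where f = prod.swap and g = prod.swap and C = 1 and D = 1])
qed (auto simp: linear_on_set_def norm_Pair add.commute)

lemma lin_iso_Times_assoc: "(U \<times> V) \<times> W \<cong> U \<times> (V \<times> W)"
proof (rule lin_isoI[where f = "\<lambda>((x, y), z). (x, (y, z))" and g = "\<lambda>(x, (y, z)). ((x, y), z)" and C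
  = 1 and D = 1])
qed (auto simp: linear_on_set_def norm_Pair add.assoc)

lemma lin_iso_imp_isomorphic_subspaces:
  assumes "U \<cong> V" shows "isomorphic_subspaces U V"
proof -
  obtain f g C where 1: "0 \<le> C" "linear_on_set U f" "linear_on_set V g"
     "\<And>x. x \<in> U \<Longrightarrow> f x \<in> V \<and> g (f x) = x \<and> norm (f x) \<le> C * norm x"
     "\<And>y. y \<in> V \<Longrightarrow> g y \<in> U \<and> f (g y) = y \<and> norm (g y) \<le> C * norm y"
    using assms(1) unfolding lin_iso_def by blast
  have "bij_betw f U V" using 1 by (intro bij_betw_byWitness[where f' = g]) auto
  moreover have "norm x \<le> C * norm (f x)" if "x \<in> U" for x using 1 that by metis
  ultimately show ?thesis
    unfolding isomorphic_subspaces_def using 1 unfolding linear_on_set_def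
    by (intro exI[of _ f]) blast
qed

text \<open>The nodes of the leftmost branch are mapped to their levels. Every other node lies at a
  position \<open>L\<close> of the subtree that branches off to the right at a unique node of the leftmost
  branch, say the one of level \<open>n\<close>; it is mapped to \<open>(n, L)\<close>.\<close>
primrec locate :: "bool list \<Rightarrow> nat + nat \<times> bool list" where
  "locate [] = Inl 0"
| "locate (b # K) = (case locate K of
      Inl n \<Rightarrow> if b then Inr (n, []) else Inl (Suc n)
    | Inr (n, L) \<Rightarrow> Inr (n, b # L))"

definition spine :: "nat \<Rightarrow> bool list" where
  "spine n = replicate n False"

lemma locate_spine: "locate (spine n) = Inl n"
  by (induction n) (auto simp: spine_def)

lemma locate_branch: "locate (L @ True # spine n) = Inr (n, L)"
  by (induction L) (auto simp: locate_spine)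

lemma locate_Inl: "locate K = Inl n \<Longrightarrow> K = spine n"
  by (induction K arbitrary: n) (auto simp: spine_def split: sum.splits if_splits)

lemma locate_Inr: "locate K = Inr (n, L) \<Longrightarrow> K = L @ True # spine n"
  by (induction K arbitrary: n L) (auto split: sum.splits if_splits dest: locate_Inl)

definition subtree :: "nat \<Rightarrow> SL_inf \<Rightarrow> SL_inf" where
  "subtree n f = of_coef (\<lambda>L. coef f (L @ True # spine n))"

text \<open>The inverse operation of taking \<open>f\<close> apart into its coefficients on the leftmost branch and
  its restrictions \<open>subtree n f\<close>. It is applied only to coefficients \<open>a\<close> that come from a vector
  and to bounded sequences \<open>x\<close>.\<close>
definition glue :: "(nat \<Rightarrow> real) \<Rightarrow> (nat \<Rightarrow> SL_inf) \<Rightarrow> SL_inf" where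
  "glue a x = of_coef (\<lambda>K. case locate K of Inl n \<Rightarrow> a n | Inr (n, L) \<Rightarrow> coef (x n) L)"

lemma path_sum_append: "path_sum a (L @ M) = path_sum (\<lambda>L. a (L @ M)) L + path_sum a M"
  by (induction L) auto

lemma path_sum_subtree: "path_sum (\<lambda>L. coef f (L @ M)) L \<le> (norm f)\<^sup>2"
  using path_sum_le_norm[of f "L @ M"] path_sum_nonneg[of "coef f" M] unfolding path_sum_append
    by linarith

lemma coef_subtree: "coef (subtree n f) L = coef f (L @ True # spine n)"
  unfolding subtree_def coef_of_coef[OF path_sum_subtree] ..

lemma norm_subtree_le: "norm (subtree n f) \<le> norm f"
  unfolding norm_le_iff_path_sum[OF norm_ge_zero] coef_subtree[abs_def] using path_sum_subtree
    by blast

lemma path_sum_spine: "path_sum (coef f) (spine n) = (\<Sum>i<n. (coef f (spine i))\<^sup>2)"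
  by (induction n) (auto simp: spine_def)

lemma path_sum_glue:
  assumes "\<And>n. norm (x n) \<le> B"
  shows "path_sum (\<lambda>K. case locate K of Inl n \<Rightarrow> coef f (spine n) | Inr (n, L) \<Rightarrow> coef (x n) L) K
    \<le> (norm f + B)\<^sup>2"
proof -
  let ?a = "\<lambda>K. case locate K of Inl n \<Rightarrow> coef f (spine n) | Inr (n, L) \<Rightarrow> coef (x n) L"
  have eq: "path_sum ?a K = (case locate K of Inl n \<Rightarrow> path_sum (coef f) (spine n)
     | Inr (n, L) \<Rightarrow> path_sum (coef f) (spine (Suc n)) + path_sum (coef (x n)) L)"
    by (induction K) (auto simp: path_sum_spine split: sum.splits)
  have B: "0 \<le> B" using order_trans[OF norm_ge_zero assms] .
  have "path_sum ?a K \<le> (norm f)\<^sup>2 + B\<^sup>2"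
  proof (cases "locate K")
    case (Inl n)
    then show ?thesis using path_sum_le_norm[of f "spine n"] unfolding eq
      by (simp add: add_increasing2)
  next
    case (Inr p)
    obtain n L where p: "p = (n, L)" by force
    have "path_sum (coef (x n)) L \<le> (norm (x n))\<^sup>2" by (rule path_sum_le_norm)
    also have "\<dots> \<le> B\<^sup>2" using assms by (intro power_mono) auto
    finally have "path_sum (coef f) (spine (Suc n)) + path_sum (coef (x n)) L \<le> (norm f)\<^sup>2 + B\<^sup>2"
      by (intro add_mono path_sum_le_norm)
    then show ?thesis unfolding eq Inr p by simp
  qed
  also have "\<dots> \<le> (norm f + B)\<^sup>2" using B by (simp add: power2_sum)
  finally show ?thesis .
qed

lemma coef_glue:
  assumes "\<And>n. norm (x n) \<le> B"
  shows "coef (glue (\<lambda>n. coef f (spine n)) x) K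
    = (case locate K of Inl n \<Rightarrow> coef f (spine n) | Inr (n, L) \<Rightarrow> coef (x n) L)"
  unfolding glue_def coef_of_coef[OF path_sum_glue[OF assms]] ..

lemma norm_glue_le:
  assumes "\<And>n. norm (x n) \<le> B"
  shows "norm (glue (\<lambda>n. coef f (spine n)) x) \<le> norm f + B"
proof (subst norm_le_iff_path_sum)
  show "0 \<le> norm f + B" using order_trans[OF norm_ge_zero assms] by simp
  show "\<forall>K. path_sum (coef (glue (\<lambda>n. coef f (spine n)) x)) K \<le> (norm f + B)\<^sup>2"
    unfolding coef_glue[OF assms, abs_def] by (intro allI path_sum_glue[OF assms])
qed

lemma subtree_glue:
  assumes "\<And>n. norm (x n) \<le> B"
  shows "subtree n (glue (\<lambda>n. coef f (spine n)) x) = x n"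
  by (rule SL_eqI) (simp add: coef_subtree coef_glue[OF assms] locate_branch)

lemma spine_glue:
  assumes "\<And>n. norm (x n) \<le> B"
  shows "coef (glue (\<lambda>n. coef f (spine n)) x) (spine n) = coef f (spine n)"
  by (simp add: coef_glue[OF assms] locate_spine)

lemma SL_eq_by_parts:
  assumes "\<And>n. coef f (spine n) = coef g (spine n)" "\<And>n. subtree n f = subtree n g"
  shows "f = g"
proof (rule SL_eqI)
  fix K
  show "coef f K = coef g K"
  proof (cases "locate K")
    case (Inl n) then show ?thesis using locate_Inl assms(1) by metis
  next
    case (Inr p)
    obtain n L where "p = (n, L)" by force
    then have "K = L @ True # spine n" using locate_Inr Inr by simp
    then show ?thesis using arg_cong[OF assms(2)[of n], of "\<lambda>f. coef f L"]
      by (simp add: coef_subtree)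
  qed
qed

lemma subtree_add [simp]: "subtree n (f + g) = subtree n f + subtree n g"
  and subtree_scale [simp]: "subtree n (c *\<^sub>R f) = c *\<^sub>R subtree n f"
  by (rule SL_eqI, simp add: coef_subtree)+

text \<open>Replace the \<open>n\<close>-th subtree \<open>x\<^sub>n\<close> of a vector by \<open>Q x\<^sub>n\<^sub>+\<^sub>1 + (x\<^sub>n - Q x\<^sub>n)\<close> and keep \<open>Q x\<^sub>0\<close>
  separately. The map \<open>down\<close> shifts the components in \<open>range Q\<close> back.\<close>
lemma range_projection_absorbed:
  fixes Q :: "SL_inf \<Rightarrow> SL_inf"
  assumes "bounded_projection Q"
  shows "(UNIV :: SL_inf set) \<cong> range Q \<times> (UNIV :: SL_inf set)"
proof -
  interpret bounded_linear Q using assms by (simp add: bounded_projection_def)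
  have QQ: "Q (Q x) = Q x" for x using assms by (simp add: bounded_projection_def fun_eq_iff)
  obtain q where q: "0 < q" "\<And>x. norm (Q x) \<le> q * norm x" using pos_bounded
    by (auto simp: mult.commute)
  define up where "up f n = Q (subtree (Suc n) f) + (subtree n f - Q (subtree n f))" for f n
  define down where "down y g n = (if n
    = 0 then y else Q (subtree (n - 1) g)) + (subtree n g - Q (subtree n g))" for y g n
  have Qs: "norm (Q (subtree n f)) \<le> q * norm f" for n f
    using order_trans[OF q(2) mult_left_mono[OF norm_subtree_le]] q(1) by auto
  have rest: "norm (subtree n f - Q (subtree n f)) \<le> (1 + q) * norm f" for n f
    using norm_triangle_ineq4[of "subtree n f" "Q (subtree n f)"] norm_subtree_le[of n f] Qs[of n f]
    by (simp add: distrib_right)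
  have up: "norm (up f n) \<le> (1 + 2 * q) * norm f" for f n
    unfolding up_def using norm_triangle_ineq[of "Q (subtree (Suc n) f)"
      "subtree n f - Q (subtree n f)"]
      Qs[of "Suc n" f] rest[of n f] by (simp add: algebra_simps)
  have down: "norm (down y g n) \<le> norm y + (1 + 2 * q) * norm g" for y g n
  proof -
    have "norm (if n = 0 then y else Q (subtree (n - 1) g)) \<le> norm y + q * norm g"
      using Qs[of "n - 1" g] q(1) by (auto simp: add_increasing)
    with norm_triangle_ineq[of "if n
      = 0 then y else Q (subtree (n - 1) g)" "subtree n g - Q (subtree n g)"] rest[of n g]
    show ?thesis unfolding down_def by (simp add: algebra_simps)
  qed
  define shift_up where "shift_up f = glue (\<lambda>n. coef f (spine n)) (up f)" for f
  define shift_down where "shift_down y g = glue (\<lambda>n. coef g (spine n)) (down y g)" for y g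
  have up_parts: "subtree n (shift_up f) = up f n" "coef (shift_up f) (spine n) = coef f (spine n)"
    for f n
    unfolding shift_up_def by (rule subtree_glue[OF up] spine_glue[OF up])+
  have down_parts: "subtree n (shift_down y g) = down y g n" "coef (shift_down y g) (spine n)
    = coef g (spine n)" for y g n
    unfolding shift_down_def by (rule subtree_glue[OF down] spine_glue[OF down])+
  define F where "F f = (Q (subtree 0 f), shift_up f)" for f
  define G where "G = (\<lambda>(y, g). shift_down y g)"
  have Q_up: "Q (up f n) = Q (subtree (Suc n) f)" for f n by (simp add: up_def add diff QQ)
  have Q_down: "Q (down y g n) = (if n = 0 then y else Q (subtree (n - 1) g))" if "Q y = y"
    for y g n
    using that by (simp add: down_def add diff QQ)
  show ?thesis
  proof (rule lin_isoI[where f = F and g = G and C = "2 + 3 * q" and D = "3 + 2 * q"])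
    have "shift_up (f + g) = shift_up f + shift_up g" "shift_up (c *\<^sub>R f) = c *\<^sub>R shift_up f"
      for f g c
      by (rule SL_eq_by_parts; simp add: up_parts up_def add diff scaleR algebra_simps)+
    then show "linear_on_set UNIV F" by (simp add: linear_on_set_def F_def add scaleR)
    have "shift_down (y + y') (f + g) = shift_down y f + shift_down y' g"
         "shift_down (c *\<^sub>R y) (c *\<^sub>R f) = c *\<^sub>R shift_down y f" for y y' f g c
      by (rule SL_eq_by_parts; simp add: down_parts down_def add diff scaleR algebra_simps)+
    then show "linear_on_set (range Q \<times> UNIV) G" by (auto simp: linear_on_set_def G_def)
    show "F f \<in> range Q \<times> UNIV" for f by (simp add: F_def)
    show "G (F f) = f" for f
      unfolding F_def G_def prod.case
      by (rule SL_eq_by_parts) (auto simp: down_parts up_parts down_def Q_up, auto simp: up_def)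
    show "F (G p) = p" if "p \<in> range Q \<times> UNIV" for p
    proof -
      obtain y g where p: "p = (y, g)" by force
      have y: "Q y = y" using that p QQ by auto
      have up_down: "up (shift_down y g) n = subtree n g" for n
        unfolding up_def down_parts Q_down[OF y] by (auto simp: down_def)
      have "shift_up (shift_down y g) = g"
        by (rule SL_eq_by_parts) (simp_all only: up_parts down_parts up_down)
      moreover have "Q (subtree 0 (shift_down y g)) = y" by (simp add: down_parts Q_down[OF y])
      ultimately show ?thesis by (simp add: F_def G_def p)
    qed
    show "norm (F f) \<le> (2 + 3 * q) * norm f" for f
      using norm_Pair_le[of "Q (subtree 0 f)" "shift_up f"] Qs[of 0 f]
        norm_glue_le[where x = "up f" and f = f, OF up]
          by (simp add: F_def shift_up_def algebra_simps)
    show "norm (G p) \<le> (3 + 2 * q) * norm p" for p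
    proof -
      obtain y g where p: "p = (y, g)" by force
      have "norm (G p) \<le> norm g + (norm y + (1 + 2 * q) * norm g)"
        unfolding p G_def prod.case shift_down_def by (rule norm_glue_le) (rule down)
      also have "\<dots> \<le> norm p + (norm p + (1 + 2 * q) * norm p)"
        using norm_fst_le[of y g] norm_snd_le[of g y] q(1) p by (intro add_mono mult_left_mono) auto
      finally show ?thesis by (simp add: algebra_simps)
    qed
  qed simp_all
qed

text \<open>The operator \<open>P \<circ> R\<close> embeds the whole space into \<open>range P\<close>, and \<open>S\<close> is a left inverse of
  it.\<close>
lemma range_projection_splits:
  fixes P R S :: "SL_inf \<Rightarrow> SL_inf"
  assumes "bounded_projection P" "bounded_linear R" "bounded_linear S" "S \<circ> P \<circ> R = id"
  shows "range P \<cong> (UNIV :: SL_inf set) \<times> {y \<in> range P. S y = 0}"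
proof -
  interpret P: bounded_linear P using assms by (simp add: bounded_projection_def)
  interpret R: bounded_linear R by fact
  interpret S: bounded_linear S by fact
  have PP: "P (P x) = P x" for x using assms(1) by (simp add: bounded_projection_def fun_eq_iff)
  have SPR: "S (P (R x)) = x" for x using assms(4) by (simp add: fun_eq_iff)
  interpret PR: bounded_linear "\<lambda>x. P (R x)"
    by (rule bounded_linear_compose[OF P.bounded_linear_axioms R.bounded_linear_axioms])
  obtain a where a: "0 < a" "\<And>x. norm (S x) \<le> a * norm x" using S.pos_bounded
    by (auto simp: mult.commute)
  obtain b where b: "0 < b" "\<And>x. norm (P (R x)) \<le> b * norm x" using PR.pos_bounded
    by (auto simp: mult.commute)
  show ?thesis
  proof (rule lin_isoI[where f = "\<lambda>y. (S y, y - P (R (S y)))" and g = "\<lambda>(x, v). P (R x) + v"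
        and C = "1 + a + b * a" and D = "1 + b"])
    show "linear_on_set (range P) (\<lambda>y. (S y, y - P (R (S y))))"
      by (auto simp: linear_on_set_def S.add S.scaleR PR.add PR.scaleR algebra_simps)
    show "linear_on_set (UNIV \<times> {y \<in> range P. S y = 0}) (\<lambda>(x, v). P (R x) + v)"
      by (auto simp: linear_on_set_def PR.add PR.scaleR algebra_simps)
    show "(S y, y - P (R (S y))) \<in> UNIV \<times> {y \<in> range P. S y = 0}" if "y \<in> range P" for y
    proof -
      have "P (y - P (R (S y))) = y - P (R (S y))" using that by (auto simp: P.diff PP)
      then have "y - P (R (S y)) \<in> range P" by (metis rangeI)
      then show ?thesis by (simp add: S.diff SPR)
    qed
    show "norm (S y, y - P (R (S y))) \<le> (1 + a + b * a) * norm y" for y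
    proof -
      have "norm (P (R (S y))) \<le> b * (a * norm y)"
        by (rule order_trans[OF b(2) mult_left_mono[OF a(2)]]) (use b in simp)
      then show ?thesis
        using norm_Pair_le[of "S y" "y - P (R (S y))"] a(2)[of y] norm_triangle_ineq4[of y
          "P (R (S y))"]
        by (simp add: algebra_simps)
    qed
    show "(case p of (x, v) \<Rightarrow> P (R x) + v) \<in> range P" if "p \<in> UNIV \<times> {y \<in> range P. S y = 0}" for p
      using that by (auto simp flip: P.add)
    show "norm (case p of (x, v) \<Rightarrow> P (R x) + v) \<le> (1 + b) * norm p" for p
    proof -
      obtain x v where p: "p = (x, v)" by force
      have "norm (P (R x)) \<le> b * norm p"
        by (rule order_trans[OF b(2) mult_left_mono]) (use b p norm_fst_le in auto)
      then show ?thesis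
        using norm_triangle_ineq[of "P (R x)" v] norm_snd_le[of v x] p by (simp add: algebra_simps)
    qed
  qed (auto simp: S.add SPR)
qed

text \<open>With \<open>X\<close> the whole space and \<open>Y = range P\<close>: \<open>Y \<cong> X \<times> V \<cong> (X \<times> X) \<times> V \<cong> X \<times> (X \<times> V) \<cong> X \<times> Y \<cong>
  Y \<times> X \<cong> X\<close>, where \<open>X \<cong> X \<times> X\<close> is \<open>range_projection_absorbed\<close> for the identity.\<close>
lemma range_projection_iso:
  fixes P R S :: "SL_inf \<Rightarrow> SL_inf"
  assumes P: "bounded_projection P" and RS: "bounded_linear R" "bounded_linear S" "S \<circ> P \<circ> R = id"
  shows "range P \<cong> (UNIV :: SL_inf set)"
proof -
  let ?X = "UNIV :: SL_inf set" and ?Y = "range P" and ?V = "{y \<in> range P. S y = 0}"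
  have "bounded_projection (id :: SL_inf \<Rightarrow> SL_inf)"
    by (simp add: bounded_projection_def id_def bounded_linear_ident fun_eq_iff)
  from range_projection_absorbed[OF this] have XX: "?X \<cong> ?X \<times> ?X" by simp
  have YXV: "?Y \<cong> ?X \<times> ?V" by (rule range_projection_splits[OF P RS])
  have "?X \<times> ?V \<cong> (?X \<times> ?X) \<times> ?V" by (rule lin_iso_Times[OF XX lin_iso_refl])
  moreover have "(?X \<times> ?X) \<times> ?V \<cong> ?X \<times> (?X \<times> ?V)" by (rule lin_iso_Times_assoc)
  moreover have "?X \<times> (?X \<times> ?V) \<cong> ?X \<times> ?Y"
    by (rule lin_iso_Times[OF lin_iso_refl lin_iso_sym[OF YXV]])
  moreover have "?X \<times> ?Y \<cong> ?Y \<times> ?X" by (rule lin_iso_Times_commute)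
  moreover have "?Y \<times> ?X \<cong> ?X" by (rule lin_iso_sym[OF range_projection_absorbed[OF P]])
  ultimately show ?thesis using YXV by (meson lin_iso_trans)
qed

theorem primary_SL_inf: "primary TYPE(SL_inf)"
  unfolding primary_def
proof (intro allI impI)
  fix Q :: "SL_inf \<Rightarrow> SL_inf" assume Q: "bounded_projection Q"
  then interpret bounded_linear Q by (simp add: bounded_projection_def)
  have QQ: "Q (Q x) = Q x" for x using Q by (simp add: bounded_projection_def fun_eq_iff)
  have Q': "bounded_projection (\<lambda>x. x - Q x)"
    unfolding bounded_projection_def
    by (auto intro!: bounded_linear_sub bounded_linear_ident bounded_linear_axioms
      simp: fun_eq_iff diff QQ)
  obtain H and R S :: "SL_inf \<Rightarrow> SL_inf" where H: "H \<in> {Q, \<lambda>x. x - Q x}"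
    and RS: "bounded_linear R" "bounded_linear S" "S \<circ> H \<circ> R = id"
    using factorization[OF bounded_linear_axioms zero_less_one] by blast
  have "bounded_projection H" using H Q Q' by auto
  from lin_iso_imp_isomorphic_subspaces[OF range_projection_iso[OF this RS]]
  show "isomorphic_subspaces (range Q) (UNIV :: SL_inf set) \<or>
      isomorphic_subspaces (range (\<lambda>x. x - Q x)) (UNIV :: SL_inf set)"
    using H by auto
qed


theorem theorem2p2:
  shows "(\<forall>(T :: SL_inf \<Rightarrow> SL_inf) (\<eta> :: real). bounded_linear T \<longrightarrow> \<eta> > 0 \<longrightarrow>
            (\<exists>H \<in> {T, (\<lambda>f. f - T f)}. \<exists>R S :: SL_inf \<Rightarrow> SL_inf.
               bounded_linear R \<and> bounded_linear S \<and> S \<circ> H \<circ> R = id \<and>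
               onorm R * onorm S \<le> 2 + \<eta>))
         \<and> primary TYPE(SL_inf)"
  using factorization primary_SL_inf by simp

end
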